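(* Let $\mathcal I(K_n)$ be the smallest magic sum $s$ over all edge-magic injections of the complete graph $K_n$. Then $$\mathcal I(K_n)\le \left(\frac{288}{121}+o(1)\right) n^2 \qquad (n\to\infty).$$
   Context: An edge-magic injection of a graph $G$ (with $V(G)\cap E(G)=\emptyset$) is an injective map $l:V(G)\cup E(G)\to\mathbb Z_{>0}$ such that for every edge $ab\in E(G)$ the sum $l(a)+l(b)+l(ab)$ equals a constant $s$ (the magic sum), independent of the edge. *)

theory Defs
  imports Complex_Main
begin

text \<open>A graph is given by a vertex set V and an edge set E of 2-element subsets of V.
  Labels are a single map on the disjoint union V + E (sum type), with values in the
  positive integers (nat with positivity).\<close>

definition edge_magic_injection ::
  "'a set \<Rightarrow> 'a set set \<Rightarrow> ('a + 'a set \<Rightarrow> nat) \<Rightarrow> nat \<Rightarrow> bool" where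
  "edge_magic_injection V E l s \<longleftrightarrow>
     inj_on l (Inl ` V \<union> Inr ` E) \<and>
     (\<forall>x \<in> Inl ` V \<union> Inr ` E. l x > 0) \<and>
     (\<forall>a b. a \<noteq> b \<and> {a, b} \<in> E \<longrightarrow> l (Inl a) + l (Inl b) + l (Inr {a, b}) = s)"

definition complete_vertices :: "nat \<Rightarrow> nat set" where
  "complete_vertices n = {..<n}"

definition complete_edges :: "nat \<Rightarrow> nat set set" where
  "complete_edges n = {{a, b} | a b. a < n \<and> b < n \<and> a \<noteq> b}"

definition I_K :: "nat \<Rightarrow> nat" where
  "I_K n = (LEAST s. \<exists>l. edge_magic_injection (complete_vertices n) (complete_edges n) l s)"

end

theory Submission
  imports Defs "HOL-Complex_Analysis.Complex_Analysis" "HOL-Number_Theory.Number_Theory"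
    "HOL-Real_Asymp.Real_Asymp"
begin

text \<open>
  For a prime \<open>p\<close>, Ruzsa's set \<open>{p k - (p - 1) g^k | k < p - 1}\<close>, with \<open>g\<close> a primitive root, is a Sidon set
  modulo \<open>M = p (p - 1)\<close>. Representing a translate of it in \<open>{1..M}\<close> gives vertex labels with
  distinct pairwise sums, and \<open>s\<close> is an admissible magic sum as soon as it is at least \<open>2 M\<close> and is not
  of the form \<open>a + b + c\<close> with \<open>a \<noteq> b\<close>. On average over the residue classes modulo \<open>M\<close> there are
  about \<open>p / 6\<close> such representations of a class; choosing a sparse class and translating it to a
  small residue \<open>j\<close>, the representations are split between the values \<open>M + j\<close> and \<open>2 M + j\<close>, and the
  reflection \<open>x \<mapsto> M + 1 - x\<close> exchanges the two. So one may take \<open>s = 2 M + O(1)\<close> and destroy all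
  representations of \<open>s\<close> by deleting about \<open>p / 12\<close> labels. The remaining \<open>n \<sim> 11 p / 12\<close> labels give
  \<open>s \<sim> 2 (12 n / 11)^2 = 288 n^2 / 121\<close>.

  To do this for every large \<open>n\<close> one needs a prime in \<open>(x, (1 + \<eta>) x)\<close> for large \<open>x\<close>. By the
  nonvanishing of zeta on the line \<open>Re s = 1\<close>, the difference \<open>- \<zeta>'/\<zeta> - \<zeta>\<close> extends holomorphically across that
  line; integrating it against \<open>(T - t)^2 e^(i u t)\<close> and integrating by parts, the sums of
  \<open>\<Lambda>(n) / n\<close> and of \<open>1 / n\<close>, smoothed with a positive kernel in \<open>ln n - u\<close>, agree up to \<open>O(1 / u)\<close>. The
  second sum has order \<open>T^2\<close>, while without primes in the window the first one is only \<open>O(T)\<close>.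
\<close>

section \<open>The zeta function to the right of \<open>Re s = 1/2\<close>\<close>

text \<open>Weierstrass M-test with a locally uniform majorant. The bound is required only from
  index 1 on: majorants of the form \<open>real n powr c\<close> vanish at 0, whereas
  \<open>zeta_term 0 s\<close> is 1.\<close>

lemma holomorphic_series:
  fixes f :: "nat \<Rightarrow> complex \<Rightarrow> complex"
  assumes S: "open S" and hol: "\<And>n. f n holomorphic_on S"
    and bd: "\<And>x. x \<in> S \<Longrightarrow> \<exists>d h. 0 < d \<and> summable h \<and>
              (\<forall>n\<ge>1. \<forall>y\<in>ball x d \<inter> S. norm (f n y) \<le> (h n :: real))"
  shows "\<And>x. x \<in> S \<Longrightarrow> (\<lambda>n. f n x) sums (\<Sum>n. f n x)"
    and "(\<lambda>x. \<Sum>n. f n x) holomorphic_on S"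
    and "\<And>x. x \<in> S \<Longrightarrow> (\<lambda>n. deriv (f n) x) sums deriv (\<lambda>x. \<Sum>n. f n x) x"
proof -
  have "\<exists>g g'. \<forall>x\<in>S. (\<lambda>n. f n x) sums g x \<and> (\<lambda>n. deriv (f n) x) sums g' x \<and>
          (g has_field_derivative g' x) (at x)"
  proof (rule series_and_derivative_comparison_complex[OF S])
    show "(f n has_field_derivative deriv (f n) x) (at x)" if "x \<in> S" for n x
      using holomorphic_derivI[OF hol S that] .
    fix x assume "x \<in> S"
    from bd[OF this] obtain d h where dh: "0 < d" "summable h"
      "\<And>n y. n \<ge> 1 \<Longrightarrow> y \<in> ball x d \<inter> S \<Longrightarrow> norm (f n y) \<le> (h n :: real)"
      by blast
    have h0: "norm \<bar>h n\<bar> \<le> h n" if "n \<ge> 1" for n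
    proof -
      have "norm (f n x) \<le> h n" using dh(1) dh(3)[OF that, of x] \<open>x \<in> S\<close> by simp
      hence "h n \<ge> 0" using norm_ge_zero order_trans by blast
      thus ?thesis by simp
    qed
    \<comment> \<open>Nothing controls the sign of \<open>h 0\<close>, and the comparison test wants
      a majorant in the nonnegative reals; hence the passage to absolute values.\<close>
    have "summable (\<lambda>n. \<bar>h n\<bar>)"
      by (rule summable_comparison_test_ev[OF eventually_sequentiallyI[of 1] dh(2)]) (rule h0)
    hence "summable (\<lambda>n. complex_of_real \<bar>h n\<bar>)" by (simp only: summable_of_real_iff)
    moreover have "\<forall>\<^sub>F n in sequentially. \<forall>y\<in>ball x d \<inter> S. cmod (f n y) \<le> cmod (complex_of_real \<bar>h n\<bar>)"
    proof (rule eventually_sequentiallyI[of 1], rule ballI)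
      fix n y assume "n \<ge> (1::nat)" "y \<in> ball x d \<inter> S"
      thus "cmod (f n y) \<le> cmod (complex_of_real \<bar>h n\<bar>)" using dh(3)[of n y] by simp
    qed
    moreover have "range (\<lambda>n. complex_of_real \<bar>h n\<bar>) \<subseteq> \<real>\<^sub>\<ge>\<^sub>0" by auto
    ultimately show "\<exists>d h. 0 < d \<and> summable h \<and> range h \<subseteq> \<real>\<^sub>\<ge>\<^sub>0 \<and>
         (\<forall>\<^sub>F n in sequentially. \<forall>y\<in>ball x d \<inter> S. cmod (f n y) \<le> cmod (h n))"
      using dh(1) by blast
  qed
  then obtain g g' where g: "\<And>x. x \<in> S \<Longrightarrow> (\<lambda>n. f n x) sums g x"
    "\<And>x. x \<in> S \<Longrightarrow> (\<lambda>n. deriv (f n) x) sums g' x"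
    "\<And>x. x \<in> S \<Longrightarrow> (g has_field_derivative g' x) (at x)" by blast
  have gs: "(\<Sum>n. f n x) = g x" if "x \<in> S" for x
    using g(1)[OF that] by (simp add: sums_iff)
  have der: "((\<lambda>x. \<Sum>n. f n x) has_field_derivative g' x) (at x)" if "x \<in> S" for x
    by (rule has_field_derivative_transform_within_open[OF g(3)[OF that] S that]) (simp add: gs)
  show "(\<lambda>n. f n x) sums (\<Sum>n. f n x)" if "x \<in> S" for x
    using g(1)[OF that] gs[OF that] by simp
  show "(\<lambda>x. \<Sum>n. f n x) holomorphic_on S"
    using der by (auto simp: holomorphic_on_open[OF S])
  show "(\<lambda>n. deriv (f n) x) sums deriv (\<lambda>x. \<Sum>n. f n x) x" if "x \<in> S" for x
    using g(2)[OF that] DERIV_imp_deriv[OF der[OF that]] by simp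
qed

text \<open>Since \<open>0 powr s = 0\<close> for every \<open>s\<close>, the term of index 0 is 1. So the telescoping part of the
  series sums to 0, and the series is \<open>(s - 1) \<zeta>(s)\<close> where \<open>\<zeta>\<close> is given by its Dirichlet series.\<close>

definition zeta_term :: "nat \<Rightarrow> complex \<Rightarrow> complex" where
  "zeta_term n s = (s - 1) * of_nat n powr (-s) + of_nat (Suc n) powr (1 - s) - of_nat n powr (1 - s)"

lemma holomorphic_nat_powr [holomorphic_intros]:
  assumes "f holomorphic_on S"
  shows "(\<lambda>s. of_nat n powr (f s) :: complex) holomorphic_on S"
proof (cases "n = 0")
  case False
  thus ?thesis using assms by (auto simp: powr_def intro!: holomorphic_intros)
qed auto

lemma norm_nat_powr: "norm (of_nat n powr s :: complex) = real n powr Re s"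
  using norm_powr_real_powr[of "of_nat n" s] by simp

text \<open>\<open>zeta_term n s\<close> is the remainder of the first-order Taylor expansion of
  \<open>x powr (1 - s)\<close> at \<open>n\<close>, evaluated at \<open>n + 1\<close>. The second
  derivative bounds it, and this gains a factor \<open>1 / n\<close> over the terms of the Dirichlet
  series.\<close>

lemma norm_zeta_term_le:
  assumes "n \<ge> 1" "Re s > 0"
  shows "norm (zeta_term n s) \<le> norm (1 - s) * norm s * real n powr (- Re s - 1)"
proof -
  let ?S = "closed_segment (of_nat n :: complex) (of_nat (Suc n))"
  have S: "\<exists>r\<ge>real n. x = of_real r" if "x \<in> ?S" for x
  proof -
    from that obtain u where u: "0 \<le> u" "u \<le> 1" "x = (1 - u) *\<^sub>R of_nat n + u *\<^sub>R of_nat (Suc n)"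
      by (auto simp: in_segment)
    hence "x = of_real (real n + u)" by (simp add: scaleR_conv_of_real algebra_simps)
    with u show ?thesis by (intro exI[of _ "real n + u"]) auto
  qed
  define f :: "nat \<Rightarrow> complex \<Rightarrow> complex" where
    "f = (\<lambda>i x. if i = 0 then x powr (1 - s) else if i = 1 then (1 - s) * x powr (-s)
        else (1 - s) * (-s) * x powr (-s - 1))"
  have "cmod (f 0 (of_nat (Suc n)) - (\<Sum>i\<le>1. f i (of_nat n) * (of_nat (Suc n) - of_nat n) ^ i / fact i))
     \<le> (norm (1 - s) * norm s * real n powr (- Re s - 1)) * cmod (of_nat (Suc n) - of_nat n) ^ Suc 1 / fact 1"
  proof (rule complex_Taylor)
    fix i :: nat and x assume x: "x \<in> ?S" "i \<le> 1"
    from S[OF x(1)] obtain r where r: "r \<ge> real n" "x = of_real r" by blast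
    hence x0: "x \<notin> \<real>\<^sub>\<le>\<^sub>0" using assms by auto
    have d: "((\<lambda>x. x powr w) has_field_derivative w * x powr (w - 1)) (at x within ?S)" for w
      by (rule has_field_derivative_at_within[OF has_field_derivative_powr[OF x0]])
    from x consider "i = 0" | "i = 1" by linarith
    thus "(f i has_field_derivative f (Suc i) x) (at x within ?S)"
    proof cases
      case 1
      thus ?thesis using d[of "1 - s"] by (simp add: f_def)
    next
      case 2
      thus ?thesis using DERIV_cmult[OF d[of "- s"], of "1 - s"] by (simp add: f_def mult.assoc)
    qed
  next
    fix x assume x: "x \<in> ?S"
    from S[OF x(1)] obtain r where r: "r \<ge> real n" "x = of_real r" by blast
    have "r powr (- Re s - 1) \<le> real n powr (- Re s - 1)"
      using r assms by (intro powr_mono2') auto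
    thus "cmod (f (Suc 1) x) \<le> norm (1 - s) * norm s * real n powr (- Re s - 1)"
      using r assms norm_powr_real_powr[of x "-s-1"] by (auto simp: f_def norm_mult intro!: mult_left_mono)
  qed auto
  thus ?thesis by (simp add: f_def zeta_term_def algebra_simps)
qed

definition zeta_num :: "complex \<Rightarrow> complex" where
  "zeta_num s = (\<Sum>n. zeta_term n s)"

text \<open>An open region around the line Re s = 1 on which the single exponent -3/2 serves in the
  majorant at every point.\<close>

definition half_plane :: "complex set" where "half_plane = {s. Re s > 1/2}"

lemma open_half_plane: "open half_plane" unfolding half_plane_def by (rule open_halfspace_Re_gt)

lemma half_plane_iff: "s \<in> half_plane \<longleftrightarrow> Re s > 1/2" by (simp add: half_plane_def)

lemma connected_half_plane: "connected half_plane" unfolding half_plane_def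
  by (intro convex_connected convex_halfspace_Re_gt)

lemma zeta_num_series:
  shows "\<And>s. s \<in> half_plane \<Longrightarrow> (\<lambda>n. zeta_term n s) sums zeta_num s"
    and "zeta_num holomorphic_on half_plane"
proof -
  have bd: "\<exists>d h. 0 < d \<and> summable h \<and>
              (\<forall>n\<ge>1. \<forall>y\<in>ball x d \<inter> half_plane. norm (zeta_term n y) \<le> (h n :: real))" if "x \<in> half_plane" for x
  proof (intro exI conjI ballI allI impI)
    show "(0::real) < 1" by simp
    show "summable (\<lambda>n. (norm x + 2) * (norm x + 1) * real n powr (- (3/2)))"
      by (intro summable_mult) (simp add: summable_real_powr_iff)
    fix n y assume n: "n \<ge> (1::nat)" and y: "y \<in> ball x 1 \<inter> half_plane"
    have "norm y \<le> norm x + 1"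
      using y norm_triangle_ineq3[of y x] by (auto simp: dist_norm norm_minus_commute)
    moreover have "norm (1 - y) \<le> 1 + norm y" using norm_triangle_ineq4[of 1 y] by simp
    moreover have "real n powr (- Re y - 1) \<le> real n powr (-(3/2))"
      using n y by (intro powr_mono) (auto simp: half_plane_iff)
    ultimately have "norm (1 - y) * norm y * real n powr (- Re y - 1) \<le>
        (norm x + 2) * (norm x + 1) * real n powr (- (3/2))"
      by (intro mult_mono) auto
    thus "norm (zeta_term n y) \<le> (norm x + 2) * (norm x + 1) * real n powr (- (3/2))"
      using norm_zeta_term_le[OF n, of y] y by (auto simp: half_plane_iff)
  qed
  have hol: "zeta_term n holomorphic_on half_plane" for n
    unfolding zeta_term_def[abs_def] by (intro holomorphic_intros)
  note * = holomorphic_series[OF open_half_plane hol bd]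
  show "(\<lambda>n. zeta_term n s) sums zeta_num s" if "s \<in> half_plane" for s
    using *(1) that by (simp add: zeta_num_def)
  show "zeta_num holomorphic_on half_plane" using *(2) unfolding zeta_num_def[abs_def] by simp
qed

text \<open>This is the residue of zeta at its pole. It also shows that \<open>zeta_num\<close> is
  not the zero function, so that its zeros have finite order.\<close>

lemma zeta_num_1: "zeta_num 1 = 1"
proof -
  have "zeta_term n 1 = (if n = 0 then 1 else 0)" for n
    by (auto simp: zeta_term_def simp del: of_nat_Suc)
  hence "(\<lambda>n. zeta_term n 1) sums 1" using sums_single[of 0 "\<lambda>_. 1::complex"] by simp
  moreover have "(\<lambda>n. zeta_term n 1) sums zeta_num 1"
    by (rule zeta_num_series) (simp add: half_plane_iff)
  ultimately show ?thesis using sums_unique2 by blast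
qed

section \<open>The Dirichlet series of zeta and its derivative for Re s > 1\<close>

definition zeta :: "complex \<Rightarrow> complex" where
  "zeta s = (\<Sum>n. of_nat n powr (-s))"

lemma summable_log_powr:
  assumes "\<sigma> > 1"
  shows "summable (\<lambda>n. ln (real n) * real n powr (-\<sigma>))"
proof -
  \<comment> \<open>Half of the excess of \<open>\<sigma>\<close> over 1 pays for the logarithm; the
    remaining exponent \<open>\<sigma> - e\<close> still exceeds 1.\<close>
  define e where "e = (\<sigma> - 1) / 2"
  have e: "e > 0" using assms by (simp add: e_def)
  have "summable (\<lambda>n. real n powr (-(\<sigma> - e)) / e)"
    by (intro summable_divide) (use assms in \<open>simp add: summable_real_powr_iff e_def field_simps\<close>)
  moreover {have "norm (ln (real n) * real n powr (-\<sigma>)) \<le> real n powr (-(\<sigma> - e)) / e" if "n \<ge> 1" for n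
  proof -
    have "ln (real n) \<le> real n powr e / e" using that e by (intro ln_powr_bound) auto
    hence "ln (real n) * real n powr (-\<sigma>) \<le> real n powr e / e * real n powr (-\<sigma>)"
      by (intro mult_right_mono) auto
    also have "\<dots> = real n powr (-(\<sigma> - e)) / e" by (simp add: powr_add[symmetric] algebra_simps)
    finally show ?thesis using that by (simp add: abs_mult)
  qed
  hence "\<forall>\<^sub>F n in sequentially. norm (ln (real n) * real n powr (-\<sigma>)) \<le> real n powr (-(\<sigma> - e)) / e"
    by (rule eventually_sequentiallyI[of 1])}
  ultimately show ?thesis by (rule summable_comparison_test_ev[rotated])
qed

lemma open_Re_gt_1: "open {s. Re s > 1}" by (rule open_halfspace_Re_gt)

lemma zeta_series:
  shows "\<And>s. Re s > 1 \<Longrightarrow> (\<lambda>n. of_nat n powr (-s)) sums zeta s"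
    and "zeta holomorphic_on {s. Re s > 1}"
    and "\<And>s. Re s > 1 \<Longrightarrow> (\<lambda>n. - (of_real (ln (real n))) * of_nat n powr (-s)) sums deriv zeta s"
proof -
  have bd: "\<exists>d h. 0 < d \<and> summable h \<and>
     (\<forall>n\<ge>1. \<forall>y\<in>ball x d \<inter> {s. Re s > 1}. norm (of_nat n powr (-y) :: complex) \<le> (h n :: real))"
    if "x \<in> {s. Re s > 1}" for x
  proof (intro exI conjI ballI allI impI)
    define d where "d = (Re x - 1) / 2"
    show "0 < d" using that by (simp add: d_def)
    show "summable (\<lambda>n. real n powr (- (1 + d)))"
      using that by (simp add: summable_real_powr_iff d_def)
    fix n y assume n: "n \<ge> (1::nat)" and y: "y \<in> ball x d \<inter> {s. Re s > 1}"
    have "\<bar>Re x - Re y\<bar> < d" using y abs_Re_le_cmod[of "x - y"] by (auto simp: dist_norm)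
    hence "Re y \<ge> 1 + d" unfolding d_def by argo
    thus "norm (of_nat n powr (-y) :: complex) \<le> real n powr (- (1 + d))"
      using n by (auto simp: norm_nat_powr intro!: powr_mono)
  qed
  have hol: "(\<lambda>s. of_nat n powr (-s)) holomorphic_on {s. Re s > 1}" for n
    by (intro holomorphic_intros)
  note * = holomorphic_series[OF open_Re_gt_1 hol bd]
  show "(\<lambda>n. of_nat n powr (-s)) sums zeta s" if "Re s > 1" for s
    using *(1) that by (simp add: zeta_def)
  show "zeta holomorphic_on {s. Re s > 1}" using *(2) unfolding zeta_def[abs_def] by simp
  have der: "deriv (\<lambda>s. of_nat n powr (-s)) s = - (of_real (ln (real n))) * of_nat n powr (-s)" for n and s :: complex
  proof (cases "n = 0")
    case False
    show ?thesis
      by (rule DERIV_imp_deriv)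
         (use False in \<open>auto simp: powr_def Ln_of_nat intro!: derivative_eq_intros\<close>)
  qed auto
  show "(\<lambda>n. - (of_real (ln (real n))) * of_nat n powr (-s)) sums deriv zeta s" if "Re s > 1" for s
  proof -
    have z: "zeta = (\<lambda>s. \<Sum>n. of_nat n powr (-s))" by (simp add: zeta_def fun_eq_iff)
    have "(\<lambda>n. deriv (\<lambda>s. of_nat n powr (-s)) s) sums deriv zeta s"
      unfolding z using *(3)[of s] that by simp
    thus ?thesis by (simp only: der)
  qed
qed

lemma zeta_num_eq:
  assumes "Re s > 1"
  shows "zeta_num s = (s - 1) * zeta s"
proof -
  have "(\<lambda>n. (s - 1) * of_nat n powr (-s)) sums ((s - 1) * zeta s)"
    by (intro sums_mult zeta_series(1) assms)
  moreover have "(\<lambda>n. of_nat (Suc n) powr (1 - s) - of_nat n powr (1 - s) :: complex) sums (0 - of_nat 0 powr (1-s))"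
  proof (rule telescope_sums)
    have "(\<lambda>n. norm (of_nat n powr (1 - s) :: complex)) \<longlonglongrightarrow> 0"
      unfolding norm_nat_powr using assms
      by (intro tendsto_neg_powr filterlim_real_sequentially) simp
    thus "(\<lambda>n. of_nat n powr (1 - s) :: complex) \<longlonglongrightarrow> 0" by (rule tendsto_norm_zero_cancel)
  qed
  ultimately have "(\<lambda>n. (s - 1) * of_nat n powr (-s) + (of_nat (Suc n) powr (1 - s) - of_nat n powr (1 - s))) sums
     ((s - 1) * zeta s + (0 - of_nat 0 powr (1-s)))" by (rule sums_add)
  hence "(\<lambda>n. zeta_term n s) sums ((s - 1) * zeta s)" by (simp add: zeta_term_def algebra_simps)
  moreover have "(\<lambda>n. zeta_term n s) sums zeta_num s"
    by (rule zeta_num_series) (use assms in \<open>simp add: half_plane_iff\<close>)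
  ultimately show ?thesis using sums_unique2 by blast
qed

section \<open>Nonvanishing on the line \<open>Re s = 1\<close>\<close>

text \<open>For Re s > 1 this is the Dirichlet series of \<open>- zeta' / zeta\<close>, as
  \<open>zeta_times_lseries\<close> shows.\<close>

definition lseries :: "complex \<Rightarrow> complex" where
  "lseries s = (\<Sum>n. mangoldt n * of_nat n powr (-s))"

lemma mangoldt_le_ln: "mangoldt n \<le> ln (real n)"
  using mangoldt_le[of n] by (cases "n = 0") auto

lemma norm_mangoldt_term_le: "norm (mangoldt n * of_nat n powr (-s) :: complex) \<le> ln (real n) * real n powr (- Re s)"
  by (auto simp: norm_mult norm_nat_powr intro!: mult_right_mono mangoldt_le_ln)

lemma summable_mangoldt:
  assumes "Re s > 1"
  shows "summable (\<lambda>n. norm (mangoldt n * of_nat n powr (-s) :: complex))"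
proof (rule summable_comparison_test_ev[OF eventually_sequentiallyI[of 0]])
  show "summable (\<lambda>n. ln (real n) * real n powr (- Re s))" by (rule summable_log_powr[OF assms])
  show "norm (norm (mangoldt n * of_nat n powr (-s) :: complex)) \<le> ln (real n) * real n powr (- Re s)" for n
    using norm_mangoldt_term_le[of n s] by simp
qed

lemma lseries_sums:
  assumes "Re s > 1"
  shows "(\<lambda>n. mangoldt n * of_nat n powr (-s)) sums lseries s"
  unfolding lseries_def by (rule summable_sums[OF summable_norm_cancel[OF summable_mangoldt[OF assms]]])

text \<open>Absolute convergence makes the double series over pairs of positive integers summable,
  so it may be evaluated either row by row or grouped by the product of the indices. The vanishing
  at 0 allows passing between positive indices and all naturals.\<close>

lemma sums_dirichlet_product:
  fixes f g :: "nat \<Rightarrow> complex"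
  assumes f: "summable (\<lambda>n. norm (f n))" and g: "summable (\<lambda>n. norm (g n))"
    and f0: "f 0 = 0" and g0: "g 0 = 0"
  shows "(\<lambda>n. if n = 0 then 0 else \<Sum>d | d dvd n. f (n div d) * g d) sums ((\<Sum>n. f n) * (\<Sum>n. g n))"
proof -
  let ?N = "{1::nat..}"
  define F where "F = (\<lambda>(m, d). f m * g d)"
  have fN: "(f has_sum (\<Sum>n. f n)) ?N" and gN: "(g has_sum (\<Sum>n. g n)) ?N"
    using norm_summable_imp_has_sum[OF f summable_sums[OF summable_norm_cancel[OF f]]]
      norm_summable_imp_has_sum[OF g summable_sums[OF summable_norm_cancel[OF g]]] f0 g0
    by (auto elim!: has_sum_cong_neutral[THEN iffD1, rotated -1] simp: not_le Suc_le_eq intro!: Nat.gr0I)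
  have fa: "(\<lambda>n. norm (f n)) summable_on ?N" and ga: "(\<lambda>n. norm (g n)) summable_on ?N"
    using f g norm_summable_imp_summable_on[of "\<lambda>n. norm (f n)"] norm_summable_imp_summable_on[of "\<lambda>n. norm (g n)"]
    by (auto intro: summable_on_subset_banach)
  have "(\<lambda>x. norm (F x)) summable_on ?N \<times> ?N"
    unfolding Infinite_Sum.abs_summable_on_Sigma_iff F_def using fa ga
    by (auto simp: norm_mult infsum_cmult_right' abs_mult infsum_nonneg intro!: summable_on_cmult_right summable_on_cmult_left)
  hence "F summable_on ?N \<times> ?N" by (rule Infinite_Sum.abs_summable_summable)
  then obtain S where S: "(F has_sum S) (?N \<times> ?N)" by (auto simp: summable_on_def)
  have "((\<lambda>m. f m * (\<Sum>n. g n)) has_sum S) ?N"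
    by (rule has_sum_SigmaD[OF S]) (use gN in \<open>auto simp: F_def intro!: has_sum_cmult_right\<close>)
  moreover have "((\<lambda>m. f m * (\<Sum>n. g n)) has_sum (\<Sum>n. f n) * (\<Sum>n. g n)) ?N"
    by (intro has_sum_cmult_left fN)
  ultimately have S_eq: "S = (\<Sum>n. f n) * (\<Sum>n. g n)" by (rule has_sum_unique)
  \<comment> \<open>Recording the pair \<open>(m, d)\<close> as \<open>(m * d, d)\<close> turns the
    index set into pairs of a positive integer and one of its divisors.\<close>
  have "((\<lambda>(n, d). f (n div d) * g d) has_sum S) (Sigma ?N (\<lambda>n. {d. d dvd n}))"
  proof -
    have "(F has_sum S) (?N \<times> ?N) = ((\<lambda>(n, d). f (n div d) * g d) has_sum S) (Sigma ?N (\<lambda>n. {d. d dvd n}))"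
    proof (rule has_sum_reindex_bij_witness[where j = "\<lambda>(m, d). (m * d, d)" and i = "\<lambda>(n, d). (n div d, d)"])
      fix b assume "b \<in> Sigma ?N (\<lambda>n. {d. d dvd n})"
      then obtain n d where b: "b = (n, d)" "n \<ge> 1" "d dvd n" by auto
      then obtain k where k: "n = d * k" by (elim dvdE)
      show "(case case b of (n, d) \<Rightarrow> (n div d, d) of (m, d) \<Rightarrow> (m * d, d)) = b" using b by simp
      show "(case b of (n, d) \<Rightarrow> (n div d, d)) \<in> ?N \<times> ?N" using b(1,2) k by (auto simp: Suc_le_eq)
    qed (auto simp: F_def)
    thus ?thesis using S by simp
  qed
  hence "((\<lambda>n. \<Sum>d | d dvd n. f (n div d) * g d) has_sum S) ?N"
    by (rule has_sum_SigmaD) (auto intro!: has_sum_finiteI)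
  hence "((\<lambda>n. if n = 0 then 0 else \<Sum>d | d dvd n. f (n div d) * g d) has_sum S) UNIV"
    by (auto elim!: has_sum_cong_neutral[THEN iffD1, rotated -1] simp: not_le Suc_le_eq intro!: Nat.gr0I)
  thus ?thesis unfolding S_eq by (rule has_sum_imp_sums)
qed

text \<open>On coefficients this is the identity that \<open>mangoldt d\<close>, summed over the
  divisors \<open>d\<close> of \<open>n\<close>, gives \<open>ln n\<close>.\<close>

lemma zeta_times_lseries:
  assumes "Re s > 1"
  shows "zeta s * lseries s = - deriv zeta s"
proof -
  have "summable (\<lambda>n. norm (of_nat n powr (-s) :: complex))"
    unfolding norm_nat_powr using assms by (simp add: summable_real_powr_iff)
  note * = sums_dirichlet_product[OF this summable_mangoldt[OF assms]]
  have "(\<lambda>n. if n = 0 then 0 else \<Sum>d | d dvd n. of_nat (n div d) powr (-s) * (mangoldt d * of_nat d powr (-s)))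
     sums (zeta s * lseries s)"
    using * by (simp add: zeta_def lseries_def)
  also have "(\<lambda>n. if n = 0 then 0 else \<Sum>d | d dvd n. of_nat (n div d) powr (-s) * (mangoldt d * of_nat d powr (-s)))
     = (\<lambda>n. of_real (ln (real n)) * of_nat n powr (-s))"
  proof
    fix n :: nat
    have "(\<Sum>d | d dvd n. of_nat (n div d) powr (-s) * (mangoldt d * of_nat d powr (-s)))
       = (\<Sum>d | d dvd n. mangoldt d * of_nat n powr (-s))"
      if "n > 0"
    proof (rule sum.cong[OF refl])
      fix d assume "d \<in> {d. d dvd n}"
      then obtain k where "n = d * k" by (auto elim: dvdE)
      hence k: "n = k * d" by simp
      have "of_nat n powr (-s) = of_nat k powr (-s) * (of_nat d powr (-s) :: complex)"
        unfolding k of_nat_mult by (rule powr_times_real) auto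
      thus "of_nat (n div d) powr (-s) * (mangoldt d * of_nat d powr (-s)) = mangoldt d * of_nat n powr (-s)"
        using k that by simp
    qed
    also have "(\<Sum>d | d dvd n. mangoldt d * of_nat n powr (-s)) = of_real (ln (real n)) * of_nat n powr (-s)" if "n > 0"
      using mangoldt_sum[of n, where ?'a = complex] that by (simp add: sum_distrib_right[symmetric])
    finally show "(if n = 0 then 0 else \<Sum>d | d dvd n. of_nat (n div d) powr (-s) * (mangoldt d * of_nat d powr (-s)))
       = of_real (ln (real n)) * of_nat n powr (-s)" by simp
  qed
  finally have "(\<lambda>n. of_real (ln (real n)) * of_nat n powr (-s)) sums (zeta s * lseries s)" .
  from sums_minus[OF this] have "(\<lambda>n. - of_real (ln (real n)) * of_nat n powr (-s)) sums (- (zeta s * lseries s))"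
    by simp
  from sums_unique2[OF this zeta_series(3)[OF assms]] show ?thesis by (simp add: eq_commute minus_equation_iff)
qed

text \<open>Logarithmic differentiation of \<open>zeta_num s = (s - 1) * zeta s\<close>. The
  right-hand side also makes sense to the left of the line Re s = 1.\<close>

lemma lseries_eq:
  assumes s: "Re s > 1" and nz: "zeta_num s \<noteq> 0"
  shows "lseries s = 1 / (s - 1) - deriv zeta_num s / zeta_num s"
proof -
  have s1: "s \<noteq> 1" using s by auto
  have "(zeta has_field_derivative deriv zeta s) (at s)"
    using holomorphic_derivI[OF zeta_series(2) open_Re_gt_1] s by simp
  hence "((\<lambda>s. (s - 1) * zeta s) has_field_derivative zeta s + (s - 1) * deriv zeta s) (at s)"
    by (auto intro!: derivative_eq_intros)
  hence "(zeta_num has_field_derivative zeta s + (s - 1) * deriv zeta s) (at s)"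
    by (rule has_field_derivative_transform_within_open[OF _ open_Re_gt_1]) (use s in \<open>auto simp: zeta_num_eq\<close>)
  hence d: "deriv zeta_num s = zeta s - (s - 1) * (zeta s * lseries s)"
    using zeta_times_lseries[OF s] by (simp add: DERIV_imp_deriv)
  have z: "zeta s \<noteq> 0" using nz zeta_num_eq[OF s] by auto
  have "(zeta s - (s - 1) * (zeta s * lseries s)) / ((s - 1) * zeta s) =
      zeta s / ((s - 1) * zeta s) - ((s - 1) * zeta s * lseries s) / ((s - 1) * zeta s)"
    by (simp add: diff_divide_distrib mult.assoc)
  also have "\<dots> = 1 / (s - 1) - lseries s" using s1 z by simp
  finally show ?thesis unfolding d zeta_num_eq[OF s] by simp
qed

section \<open>Order of vanishing and the 3-4-1 argument\<close>

text \<open>\<open>\<mu>\<close> is the order of the zero at \<open>s0\<close>, and 0 if there is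
  none. Writing \<open>zeta_num\<close> as \<open>(w - s0) ^ \<mu>\<close> times a nonvanishing
  factor, the logarithmic derivative has a simple pole with residue \<open>\<mu>\<close>, which is
  read off along the ray to the right of \<open>s0\<close>.\<close>

lemma zeta_num_order:
  assumes s0: "s0 \<in> half_plane"
  obtains \<mu> :: nat where "zeta_num s0 = 0 \<Longrightarrow> \<mu> > 0"
    "\<forall>\<^sub>F \<delta> in at_right 0. zeta_num (s0 + of_real \<delta>) \<noteq> 0"
    "((\<lambda>\<delta>. of_real \<delta> * (deriv zeta_num (s0 + of_real \<delta>) / zeta_num (s0 + of_real \<delta>))) \<longlongrightarrow> of_nat \<mu>) (at_right 0)"
proof -
  have "\<exists>\<mu> g r. 0 < r \<and> ball s0 r \<subseteq> half_plane \<and> g holomorphic_on ball s0 r \<and>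
      (\<forall>w\<in>ball s0 r. zeta_num w = (w - s0) ^ \<mu> * g w) \<and> (\<forall>w\<in>ball s0 r. g w \<noteq> 0) \<and> (zeta_num s0 = 0 \<longrightarrow> \<mu> > 0)"
  proof (cases "zeta_num s0 = 0")
    case True
    have "\<not> zeta_num constant_on half_plane"
    proof
      assume "zeta_num constant_on half_plane"
      then obtain c where "\<And>x. x \<in> half_plane \<Longrightarrow> zeta_num x = c" by (auto simp: constant_on_def)
      from this[of s0] this[of 1] show False using True zeta_num_1 s0 by (simp add: half_plane_iff)
    qed
    from holomorphic_factor_zero_nonconstant[OF zeta_num_series(2) open_half_plane connected_half_plane s0 True this]
    obtain g r n where "0 < n"  "0 < r"  "ball s0 r \<subseteq> half_plane" "g holomorphic_on ball s0 r"
      "\<And>w. w \<in> ball s0 r \<Longrightarrow> zeta_num w = (w - s0)^n * g w" "\<And>w. w \<in> ball s0 r \<Longrightarrow> g w \<noteq> 0" by metis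
    thus ?thesis by (intro exI[of _ n] exI[of _ g] exI[of _ r]) simp
  next
    case False
    have "continuous_on half_plane zeta_num" by (intro holomorphic_on_imp_continuous_on zeta_num_series(2))
    then obtain e where e: "e > 0" "\<And>y. dist s0 y < e \<Longrightarrow> zeta_num y \<noteq> 0"
      using continuous_on_open_avoid[of half_plane zeta_num s0 0] open_half_plane s0 False by blast
    obtain e' where e': "e' > 0" "ball s0 e' \<subseteq> half_plane"
      using openE[OF open_half_plane s0] by blast
    \<comment> \<open>Without a zero the order is 0 and \<open>zeta_num\<close> itself is the
      nonvanishing factor.\<close>
    show ?thesis
    proof (intro exI[of _ "0::nat"] exI[of _ zeta_num] exI[of _ "min e e'"] conjI ballI impI)
      show "zeta_num holomorphic_on ball s0 (min e e')"
        by (rule holomorphic_on_subset[OF zeta_num_series(2)]) (use e'(2) in auto)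
    qed (use e e' False in auto)
  qed
  then obtain \<mu> g r where r: "0 < r" and sub: "ball s0 r \<subseteq> half_plane" and g: "g holomorphic_on ball s0 r"
      and eq: "\<And>w. w \<in> ball s0 r \<Longrightarrow> zeta_num w = (w - s0) ^ \<mu> * g w"
      and nz: "\<And>w. w \<in> ball s0 r \<Longrightarrow> g w \<noteq> 0" and pos: "zeta_num s0 = 0 \<longrightarrow> \<mu> > 0" by blast
  have ev: "\<forall>\<^sub>F \<delta> in at_right 0. 0 < \<delta> \<and> \<delta> < r"
    using r eventually_at_right_field by blast
  have ld: "of_real \<delta> * (deriv zeta_num (s0 + of_real \<delta>) / zeta_num (s0 + of_real \<delta>))
      = of_nat \<mu> + of_real \<delta> * (deriv g (s0 + of_real \<delta>) / g (s0 + of_real \<delta>))"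
    if "0 < \<delta>" "\<delta> < r" for \<delta> :: real
  proof -
    let ?w = "s0 + of_real \<delta>"
    have w: "?w \<in> ball s0 r" using that by (simp add: dist_norm)
    have "(g has_field_derivative deriv g ?w) (at ?w)" by (rule holomorphic_derivI[OF g open_ball w])
    hence "((\<lambda>w. (w - s0) ^ \<mu> * g w) has_field_derivative
        (of_nat \<mu> * (?w - s0) ^ (\<mu> - 1)) * g ?w + (?w - s0) ^ \<mu> * deriv g ?w) (at ?w)"
      by (auto intro!: derivative_eq_intros)
    hence "(zeta_num has_field_derivative
        (of_nat \<mu> * (?w - s0) ^ (\<mu> - 1)) * g ?w + (?w - s0) ^ \<mu> * deriv g ?w) (at ?w)"
      by (rule has_field_derivative_transform_within_open[OF _ open_ball w]) (simp add: eq)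
    hence "deriv zeta_num ?w = (of_nat \<mu> * of_real \<delta> ^ (\<mu> - 1)) * g ?w + of_real \<delta> ^ \<mu> * deriv g ?w"
      by (simp add: DERIV_imp_deriv)
    moreover have "zeta_num ?w = of_real \<delta> ^ \<mu> * g ?w" using eq[OF w] by simp
    \<comment> \<open>For \<open>\<mu> = 0\<close> the truncated exponent \<open>\<mu> - 1\<close>
      does no harm, since the factor \<open>of_nat \<mu>\<close> vanishes.\<close>
    moreover have "of_real \<delta> * (of_nat \<mu> * of_real \<delta> ^ (\<mu> - 1)) = (of_nat \<mu> * of_real \<delta> ^ \<mu> :: complex)"
      by (cases \<mu>) auto
    ultimately show ?thesis using nz[OF w] that by (simp add: field_simps)
  qed
  have s0b: "s0 \<in> ball s0 r" using r by simp
  have "isCont g s0" "isCont (deriv g) s0"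
    using holomorphic_on_imp_continuous_on[OF g] holomorphic_on_imp_continuous_on[OF holomorphic_deriv[OF g open_ball]]
      s0b by (auto simp: continuous_on_eq_continuous_at)
  hence t: "(g \<longlongrightarrow> g s0) (nhds s0)" "(deriv g \<longlongrightarrow> deriv g s0) (nhds s0)"
    by (simp_all add: isCont_def tendsto_at_iff_tendsto_nhds)
  have lim: "filterlim (\<lambda>\<delta>. s0 + of_real \<delta>) (nhds s0) (at_right (0::real))"
    by (auto intro!: tendsto_eq_intros)
  have "((\<lambda>\<delta>. of_nat \<mu> + of_real \<delta> * (deriv g (s0 + of_real \<delta>) / g (s0 + of_real \<delta>))) \<longlongrightarrow>
      of_nat \<mu> + of_real 0 * (deriv g s0 / g s0)) (at_right 0)"
    by (intro tendsto_intros filterlim_compose[OF t(1) lim] filterlim_compose[OF t(2) lim] nz s0b)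
  hence "((\<lambda>\<delta>. of_nat \<mu> + of_real \<delta> * (deriv g (s0 + of_real \<delta>) / g (s0 + of_real \<delta>))) \<longlongrightarrow> of_nat \<mu>) (at_right 0)"
    by simp
  hence "((\<lambda>\<delta>. of_real \<delta> * (deriv zeta_num (s0 + of_real \<delta>) / zeta_num (s0 + of_real \<delta>))) \<longlongrightarrow> of_nat \<mu>) (at_right 0)"
    by (rule Lim_transform_eventually) (use ev in eventually_elim, rule ld[symmetric], auto)
  moreover have "\<forall>\<^sub>F \<delta> in at_right 0. zeta_num (s0 + of_real \<delta>) \<noteq> 0"
    using ev
  proof eventually_elim
    case (elim \<delta>)
    hence w: "s0 + of_real \<delta> \<in> ball s0 r" by (simp add: dist_norm)
    show ?case using elim eq[OF w] nz[OF w] by simp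
  qed
  ultimately show ?thesis using that pos by blast
qed

text \<open>The residue of \<open>lseries\<close> at \<open>s0\<close>, taken from the right: 1 from
  the pole of zeta if \<open>s0 = 1\<close>, minus the order of the zero of
  \<open>zeta_num\<close>.\<close>

lemma lseries_limit:
  assumes "Re s0 \<ge> 1"
  obtains \<mu> :: nat where "zeta_num s0 = 0 \<Longrightarrow> \<mu> > 0"
    "((\<lambda>\<delta>. of_real \<delta> * lseries (s0 + of_real \<delta>)) \<longlongrightarrow> (if s0 = 1 then 1 else 0) - of_nat \<mu>) (at_right 0)"
proof -
  have "s0 \<in> half_plane" using assms by (simp add: half_plane_iff)
  then obtain \<mu> where \<mu>: "zeta_num s0 = 0 \<Longrightarrow> \<mu> > 0"
    "\<forall>\<^sub>F \<delta> in at_right 0. zeta_num (s0 + of_real \<delta>) \<noteq> 0"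
    "((\<lambda>\<delta>. of_real \<delta> * (deriv zeta_num (s0 + of_real \<delta>) / zeta_num (s0 + of_real \<delta>))) \<longlongrightarrow> of_nat \<mu>) (at_right 0)"
    using zeta_num_order by blast
  have pos: "\<forall>\<^sub>F \<delta> in at_right (0::real). 0 < \<delta>" by (simp add: eventually_at_right_less)
  have "((\<lambda>\<delta>. of_real \<delta> * (1 / (s0 + of_real \<delta> - 1))) \<longlongrightarrow> (if s0 = 1 then 1 else 0 :: complex)) (at_right 0)"
  proof (cases "s0 = 1")
    case True
    have "((\<lambda>\<delta>::real. 1::complex) \<longlongrightarrow> 1) (at_right 0)" by simp
    hence "((\<lambda>\<delta>. of_real \<delta> * (1 / (s0 + of_real \<delta> - 1))) \<longlongrightarrow> (1 :: complex)) (at_right 0)"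
      by (rule Lim_transform_eventually) (use pos in eventually_elim, simp add: True)
    thus ?thesis using True by simp
  next
    case False
    have "((\<lambda>\<delta>. of_real \<delta> * (1 / (s0 + of_real \<delta> - 1))) \<longlongrightarrow> of_real 0 * (1 / (s0 + of_real 0 - 1))) (at_right 0)"
      by (intro tendsto_intros) (use False in auto)
    thus ?thesis using False by simp
  qed
  from tendsto_diff[OF this \<mu>(3)]
  have "((\<lambda>\<delta>. of_real \<delta> * lseries (s0 + of_real \<delta>)) \<longlongrightarrow> (if s0 = 1 then 1 else 0) - of_nat \<mu>) (at_right 0)"
  proof (rule Lim_transform_eventually)
    show "\<forall>\<^sub>F \<delta> in at_right 0. of_real \<delta> * (1 / (s0 + of_real \<delta> - 1)) -
      of_real \<delta> * (deriv zeta_num (s0 + of_real \<delta>) / zeta_num (s0 + of_real \<delta>)) = of_real \<delta> * lseries (s0 + of_real \<delta>)"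
      using pos \<mu>(2)
    proof eventually_elim
      case (elim \<delta>)
      have "Re (s0 + of_real \<delta>) > 1" using assms elim by simp
      from lseries_eq[OF this elim(2)] show ?case by (simp add: right_diff_distrib)
    qed
  qed
  with \<mu>(1) that show ?thesis by blast
qed

lemma Re_nat_powr: "Re (of_nat n powr s) = real n powr Re s * cos (Im s * ln (real n))"
proof (cases "n = 0")
  case False
  hence "of_nat n powr s = exp (s * of_real (ln (real n)))" by (simp add: powr_def Ln_of_nat)
  thus ?thesis using False by (simp add: Re_exp powr_def mult_ac)
qed auto

lemma Re_lseries:
  assumes "Re s > 1"
  shows "(\<lambda>n. mangoldt n * (real n powr (- Re s) * cos (Im s * ln (real n)))) sums Re (lseries s)"
proof -
  have "(\<lambda>n. Re (mangoldt n * of_nat n powr (-s))) sums Re (lseries s)"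
    by (rule sums_Re[OF lseries_sums[OF assms]])
  also have "(\<lambda>n. Re (mangoldt n * of_nat n powr (-s))) = (\<lambda>n. mangoldt n * (real n powr (- Re s) * cos (Im s * ln (real n))))"
    by (simp add: Re_nat_powr fun_eq_iff)
  finally show ?thesis .
qed

text \<open>For Re s0 > 1 the series \<open>lseries\<close> stays bounded near \<open>s0\<close>,
  which excludes a zero. On the line itself this is the classical argument with the points 1,
  \<open>1 + i a\<close> and \<open>1 + 2 i a\<close>: a zero at \<open>1 + i a\<close> would make a
  nonnegative combination of real parts tend to a negative limit.\<close>

lemma zeta_num_nonzero:
  assumes "Re s0 \<ge> 1"
  shows "zeta_num s0 \<noteq> 0"
proof
  assume z: "zeta_num s0 = 0"
  obtain \<mu> where "zeta_num s0 = 0 \<Longrightarrow> \<mu> > 0" and lim\<mu>: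
    "((\<lambda>\<delta>. of_real \<delta> * lseries (s0 + of_real \<delta>)) \<longlongrightarrow> (if s0 = 1 then 1 else 0) - of_nat \<mu>) (at_right 0)"
    using lseries_limit[OF assms] by blast
  hence \<mu>: "\<mu> > 0" using z by simp
  have s01: "s0 \<noteq> 1" using z zeta_num_1 by auto
  have pos: "\<forall>\<^sub>F \<delta> in at_right (0::real). 0 < \<delta>" by (simp add: eventually_at_right_less)
  show False
  proof (cases "Re s0 = 1")
    case True
    define a where "a = Im s0"
    have s0: "s0 = Complex 1 a" using True by (simp add: a_def complex_eq_iff)
    obtain \<nu> where lim\<nu>: "((\<lambda>\<delta>. of_real \<delta> * lseries (Complex 1 (2 * a) + of_real \<delta>)) \<longlongrightarrow>
        (if Complex 1 (2 * a) = 1 then 1 else 0) - of_nat \<nu>) (at_right 0)"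
      using lseries_limit[of "Complex 1 (2 * a)"] by auto
    obtain \<kappa> where lim1: "((\<lambda>\<delta>. of_real \<delta> * lseries (1 + of_real \<delta>)) \<longlongrightarrow> 1 - of_nat \<kappa>) (at_right 0)"
      using lseries_limit[of 1] by auto
    have a: "Complex 1 (2 * a) \<noteq> 1" using s01 s0 by (auto simp: complex_eq_iff)
    \<comment> \<open>The real part of the limit is \<open>3 - 3 \<kappa> - 4 \<mu> - \<nu>\<close>,
      negative as soon as \<open>\<mu>\<close> is at least 1, while every value for
      \<open>\<delta> > 0\<close> is a sum of nonnegative terms.\<close>
    have "((\<lambda>\<delta>. Re (3 * (of_real \<delta> * lseries (1 + of_real \<delta>)) + 4 * (of_real \<delta> * lseries (s0 + of_real \<delta>)) +
        of_real \<delta> * lseries (Complex 1 (2 * a) + of_real \<delta>))) \<longlongrightarrow>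
        Re (3 * (1 - of_nat \<kappa>) + 4 * (0 - of_nat \<mu>) + (0 - of_nat \<nu>))) (at_right 0)"
      using lim\<mu> lim\<nu> lim1 s01 a by (intro tendsto_intros) auto
    moreover have "\<forall>\<^sub>F \<delta> in at_right 0. 0 \<le> Re (3 * (of_real \<delta> * lseries (1 + of_real \<delta>)) + 4 * (of_real \<delta> * lseries (s0 + of_real \<delta>)) +
        of_real \<delta> * lseries (Complex 1 (2 * a) + of_real \<delta>))"
      using pos
    proof eventually_elim
      case (elim \<delta>)
      let ?c = "\<lambda>b n. mangoldt n * (real n powr (- (1 + \<delta>)) * cos (b * ln (real n)))"
      have A: "?c 0 sums Re (lseries (1 + of_real \<delta>))" "?c a sums Re (lseries (s0 + of_real \<delta>))"
         "?c (2 * a) sums Re (lseries (Complex 1 (2 * a) + of_real \<delta>))"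
        using Re_lseries[of "1 + of_real \<delta>"] Re_lseries[of "s0 + of_real \<delta>"]
          Re_lseries[of "Complex 1 (2 * a) + of_real \<delta>"] elim by (auto simp: s0)
      have B: "(\<lambda>n. 3 * ?c 0 n + 4 * ?c a n + ?c (2 * a) n) sums
         (3 * Re (lseries (1 + of_real \<delta>)) + 4 * Re (lseries (s0 + of_real \<delta>)) +
          Re (lseries (Complex 1 (2 * a) + of_real \<delta>)))"
        by (intro sums_add sums_mult A)
      \<comment> \<open>\<open>3 + 4 cos x + cos (2 x) = 2 (1 + cos x)\<^sup>2\<close>\<close>
      have "3 * ?c 0 n + 4 * ?c a n + ?c (2 * a) n \<ge> 0" for n
      proof -
        have c2: "cos (2 * a * ln (real n)) = 2 * (cos (a * ln (real n)))\<^sup>2 - 1"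
          using cos_double_cos[of "a * ln (real n)"] by (simp add: mult.assoc)
        have "3 * ?c 0 n + 4 * ?c a n + ?c (2 * a) n =
          mangoldt n * real n powr (- (1 + \<delta>)) * (2 * (1 + cos (a * ln (real n)))\<^sup>2)"
          unfolding c2 by (simp add: algebra_simps power2_eq_square)
        also have "\<dots> \<ge> 0" by (intro mult_nonneg_nonneg mangoldt_nonneg) auto
        finally show ?thesis .
      qed
      hence "0 \<le> 3 * Re (lseries (1 + of_real \<delta>)) + 4 * Re (lseries (s0 + of_real \<delta>)) +
          Re (lseries (Complex 1 (2 * a) + of_real \<delta>))"
        using sums_le[OF _ sums_zero B] by simp
      hence "0 \<le> \<delta> * (3 * Re (lseries (1 + of_real \<delta>)) + 4 * Re (lseries (s0 + of_real \<delta>)) +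
          Re (lseries (Complex 1 (2 * a) + of_real \<delta>)))" using elim by simp
      thus ?case by (simp add: algebra_simps)
    qed
    ultimately have "0 \<le> Re (3 * (1 - of_nat \<kappa>) + 4 * (0 - of_nat \<mu>) + (0 - of_nat \<nu>))"
      by (rule tendsto_lowerbound) simp
    hence "0 \<le> 3 - 3 * real \<kappa> - 4 * real \<mu> - real \<nu>" by simp
    thus False using \<mu> by linarith
  next
    case False
    hence gt: "Re s0 > 1" using assms by simp
    \<comment> \<open>A bound for \<open>lseries\<close> at all points \<open>s0 + \<delta>\<close>
      with \<open>\<delta> > 0\<close>; thus the limit, and with it the order, is 0.\<close>
    define R where "R = (\<Sum>n. norm (mangoldt n * of_nat n powr (-s0) :: complex))"
    have "((\<lambda>\<delta>. of_real \<delta> * lseries (s0 + of_real \<delta>)) \<longlongrightarrow> 0) (at_right 0)"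
    proof (rule Lim_null_comparison)
      show "((\<lambda>\<delta>. \<delta> * R) \<longlongrightarrow> 0) (at_right 0)" by (auto intro!: tendsto_eq_intros)
      show "\<forall>\<^sub>F \<delta> in at_right 0. norm (of_real \<delta> * lseries (s0 + of_real \<delta>)) \<le> \<delta> * R"
        using pos
      proof eventually_elim
        case (elim \<delta>)
        have gt': "Re (s0 + of_real \<delta>) > 1" using gt elim by simp
        have "norm (lseries (s0 + of_real \<delta>)) \<le> (\<Sum>n. norm (mangoldt n * of_nat n powr (-(s0 + of_real \<delta>)) :: complex))"
          unfolding lseries_def by (rule summable_norm[OF summable_mangoldt[OF gt']])
        also have "\<dots> \<le> R" unfolding R_def
        proof (rule suminf_le[OF _ summable_mangoldt[OF gt'] summable_mangoldt[OF gt]])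
          fix n
          show "norm (mangoldt n * of_nat n powr (-(s0 + of_real \<delta>)) :: complex) \<le> norm (mangoldt n * of_nat n powr (-s0) :: complex)"
          proof (cases "n = 0")
            case False
            thus ?thesis unfolding norm_mult norm_nat_powr using elim
              by (intro mult_left_mono powr_mono) (auto simp: mangoldt_nonneg)
          qed auto
        qed
        finally show ?case using elim by (simp add: norm_mult)
      qed
    qed
    with lim\<mu> s01 have "(0::complex) = 0 - of_nat \<mu>"
      by (intro tendsto_unique[of "at_right (0::real)" "\<lambda>\<delta>. of_real \<delta> * lseries (s0 + of_real \<delta>)"]) auto
    thus False using \<mu> by simp
  qed
qed

section \<open>Cancellation of the poles at 1\<close>

text \<open>The function \<open>- zeta' / zeta - zeta\<close>. The two poles
  \<open>1 / (s - 1)\<close> cancel and leave the difference quotient of \<open>zeta_num\<close> at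
  1, whose removable singularity is filled in by the derivative.\<close>

definition lseries_minus_zeta :: "complex \<Rightarrow> complex" where
  "lseries_minus_zeta s = - (if s = 1 then deriv zeta_num 1 else (zeta_num s - zeta_num 1) / (s - 1)) - deriv zeta_num s / zeta_num s"

lemma lseries_minus_zeta_eq:
  assumes "Re s > 1"
  shows "lseries_minus_zeta s = lseries s - zeta s"
proof -
  have s1: "s \<noteq> 1" using assms by auto
  have "zeta_num s \<noteq> 0" using zeta_num_nonzero assms by simp
  from lseries_eq[OF assms this]
  have "lseries s = 1 / (s - 1) - deriv zeta_num s / zeta_num s" .
  moreover have "zeta s = zeta_num s / (s - 1)" using s1 zeta_num_eq[OF assms] by simp
  ultimately show ?thesis
    using s1 by (simp add: lseries_minus_zeta_def zeta_num_1 diff_divide_distrib)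
qed

text \<open>Holomorphy on a neighbourhood of the closed half-plane gives bounds on rectangles that
  touch the line Re s = 1, hence bounds uniform in \<open>\<delta>\<close> for the points
  \<open>1 + \<delta> + i t\<close>.\<close>

lemma lseries_minus_zeta_holomorphic:
  obtains U where "open U" "{s. Re s \<ge> 1} \<subseteq> U" "lseries_minus_zeta holomorphic_on U"
proof
  let ?U = "{s \<in> half_plane. zeta_num s \<noteq> 0}"
  have "?U = half_plane \<inter> zeta_num -` (- {0})" by auto
  also have "open \<dots>"
    by (intro continuous_open_preimage holomorphic_on_imp_continuous_on zeta_num_series(2) open_half_plane) auto
  finally show "open ?U" .
  show "{s. Re s \<ge> 1} \<subseteq> ?U" using zeta_num_nonzero by (auto simp: half_plane_iff)
  have Z: "zeta_num holomorphic_on ?U" by (rule holomorphic_on_subset[OF zeta_num_series(2)]) auto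
  show "lseries_minus_zeta holomorphic_on ?U" unfolding lseries_minus_zeta_def[abs_def]
    by (intro holomorphic_intros pole_lemma_open Z \<open>open ?U\<close> holomorphic_deriv) auto
qed

section \<open>Smoothed sums over primes\<close>

text \<open>Unlike for the Fejer weight \<open>T - t\<close>, the transform of the weight \<open>(T - t)\<^sup>2\<close> has no zeros. Hence the
  sums for \<open>T\<close> are controlled by those for \<open>T = 1\<close>, which takes the place of Chebyshev's estimates.\<close>

definition ker :: "real \<Rightarrow> real \<Rightarrow> real" where
  "ker T v = (if v = 0 then T ^ 3 / 3 else 2 * (T * v - sin (T * v)) / v ^ 3)"

text \<open>Identifies \<open>ker T\<close> as the cosine transform of the weight
  \<open>(T - t)^2\<close> on \<open>{0..T}\<close>.\<close>

lemma has_integral_ker: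
  assumes "T \<ge> 0"
  shows "((\<lambda>t. (T - t)\<^sup>2 * cos (t * v)) has_integral ker T v) {0..T}"
proof (cases "v = 0")
  case True
  have "((\<lambda>t. (T - t)\<^sup>2) has_integral (- ((T - T) ^ 3 / 3) - (- ((T - 0) ^ 3 / 3)))) {0..T}"
    by (rule fundamental_theorem_of_calculus[OF assms])
       (auto intro!: derivative_eq_intros simp: has_real_derivative_iff_has_vector_derivative[symmetric] power2_eq_square)
  thus ?thesis using True by (simp add: ker_def)
next
  case False
  define a where "a = 1 / v"
  have av: "a * v = 1" using False by (simp add: a_def)
  \<comment> \<open>The antiderivative obtained by integrating by parts twice. With \<open>a\<close>
    in place of \<open>1 / v\<close>, its derivative is the integrand plus a multiple of
    \<open>a * v - 1\<close>, so no division occurs in the check.\<close>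
  define G where "G = (\<lambda>t. (T - t) * (T - t) * (sin (t * v) * a) - 2 * (T - t) * (cos (t * v) * a\<^sup>2) - 2 * sin (t * v) * a ^ 3)"
  have "((\<lambda>t. (T - t)\<^sup>2 * cos (t * v)) has_integral (G T - G 0)) {0..T}"
  proof (rule fundamental_theorem_of_calculus[OF assms])
    fix t assume "t \<in> {0..T}"
    have "(G has_real_derivative (T - t)\<^sup>2 * cos (t * v) + (a * v - 1) * ((T - t)\<^sup>2 * cos (t * v)
        + 2 * (T - t) * sin (t * v) * a - 2 * cos (t * v) * a\<^sup>2)) (at t within {0..T})"
      unfolding G_def by (rule derivative_eq_intros refl)+ (simp add: algebra_simps power2_eq_square power3_eq_cube)
    thus "(G has_vector_derivative (T - t)\<^sup>2 * cos (t * v)) (at t within {0..T})"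
      by (simp add: has_real_derivative_iff_has_vector_derivative av)
  qed
  also have "G T - G 0 = ker T v"
    using False by (simp add: G_def ker_def a_def field_simps power2_eq_square power3_eq_cube)
  finally show ?thesis .
qed

lemma ker_minus [simp]: "ker T (- v) = ker T v"
  by (simp add: ker_def field_simps)

lemma ker_nonneg:
  assumes "T \<ge> 0"
  shows "ker T v \<ge> 0"
proof -
  have *: "ker T v \<ge> 0" if "v > 0" for v
    using that assms sin_x_le_x[of "T * v"] by (simp add: ker_def)
  show ?thesis
  proof (cases v "0::real" rule: linorder_cases)
    case less
    thus ?thesis using *[of "-v"] by simp
  next
    case equal
    thus ?thesis using assms by (simp add: ker_def)
  next
    case greater
    thus ?thesis by (rule *)
  qed
qed

lemma ker_le_cube:
  assumes "T \<ge> 0"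
  shows "ker T v \<le> T ^ 3 / 3"
proof (rule has_integral_le[OF has_integral_ker[OF assms, of v]])
  show "((\<lambda>t. (T - t)\<^sup>2 * cos (t * 0)) has_integral T ^ 3 / 3) {0..T}"
    using has_integral_ker[OF assms, of 0] by (simp add: ker_def)
qed (auto intro: mult_left_le)

text \<open>On this range all angles \<open>t * v\<close> are at most 60 degrees, where the cosine
  is at least 1/2; so at least half of the integral for \<open>v = 0\<close> survives.\<close>

lemma ker_ge_cube:
  assumes "T \<ge> 0" "T * \<bar>v\<bar> \<le> pi / 3"
  shows "ker T v \<ge> T ^ 3 / 6"
proof (rule has_integral_le[OF _ has_integral_ker[OF assms(1), of v]])
  show "((\<lambda>t. (T - t)\<^sup>2 * cos (t * 0) * (1/2)) has_integral T ^ 3 / 6) {0..T}"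
    using has_integral_mult_left[OF has_integral_ker[OF assms(1), of 0], of "1/2"] by (simp add: ker_def)
  fix t assume t: "t \<in> {0..T}"
  have "\<bar>t * v\<bar> \<le> T * \<bar>v\<bar>" using t by (auto simp: abs_mult intro!: mult_right_mono)
  hence "\<bar>t * v\<bar> \<le> pi / 3" using assms(2) by linarith
  hence "cos (pi / 3) \<le> cos \<bar>t * v\<bar>" by (intro cos_monotone_0_pi_le) auto
  hence "1 / 2 \<le> cos (t * v)" by (simp add: cos_60)
  thus "(T - t)\<^sup>2 * cos (t * 0) * (1 / 2) \<le> (T - t)\<^sup>2 * cos (t * v)"
    using mult_left_mono[OF \<open>1 / 2 \<le> cos (t * v)\<close>, of "(T - t)\<^sup>2"] by simp
qed

text \<open>Away from 0 the kernel grows only linearly in \<open>T\<close>, against the cube of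
  \<open>T\<close> at 0. This gap drives the existence proof for primes.\<close>

lemma ker_le_inverse_square:
  assumes "T \<ge> 0" "v \<noteq> 0"
  shows "ker T v \<le> 4 * T / v\<^sup>2"
proof -
  have *: "ker T v \<le> 4 * T / v\<^sup>2" if "v > 0" for v
  proof -
    have "- sin (T * v) \<le> T * v"
      using abs_sin_x_le_abs_x[of "T * v"] that assms by (simp add: abs_le_iff)
    hence "2 * (T * v - sin (T * v)) / v ^ 3 \<le> (4 * T * v) / v ^ 3"
      using that by (intro divide_right_mono) auto
    thus ?thesis using that by (simp add: ker_def power2_eq_square power3_eq_cube)
  qed
  show ?thesis using *[of v] *[of "-v"] assms by (cases v "0::real" rule: linorder_cases) auto
qed

lemma ker_1_ge: "ker 1 v \<ge> 1 / (20 * (1 + v\<^sup>2))"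
proof (cases "\<bar>v\<bar> \<le> pi / 3")
  case True
  hence "ker 1 v \<ge> 1 / 6" using ker_ge_cube[of 1 v] by simp
  moreover have "1 / (20 * (1 + v\<^sup>2)) \<le> 1 / 6"
    by (intro divide_left_mono) (auto intro!: mult_pos_pos add_pos_nonneg)
  ultimately show ?thesis by linarith
next
  case False
  have *: "ker 1 v \<ge> 1 / (20 * (1 + v\<^sup>2))" if "v > pi / 3" for v
  proof -
    \<comment> \<open>Beyond 104/100 one has \<open>39 * v / 40 >= 1 >= sin v\<close>, which leaves
      \<open>v / 40\<close>.\<close>
    have v: "v > 104 / 100" using that less_le_trans[OF _ pi_approx(1), of "314 / 100"] by simp
    have "v - sin v \<ge> v / 40" using v sin_le_one[of v] by linarith
    hence "2 * (v / 40) / v ^ 3 \<le> 2 * (v - sin v) / v ^ 3"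
      using v by (intro divide_right_mono) auto
    hence "ker 1 v \<ge> 1 / (20 * v\<^sup>2)" using v by (simp add: ker_def power2_eq_square power3_eq_cube)
    moreover have "1 / (20 * (1 + v\<^sup>2)) \<le> 1 / (20 * v\<^sup>2)" using v
      by (intro divide_left_mono) (auto intro!: mult_pos_pos add_pos_nonneg)
    ultimately show ?thesis by linarith
  qed
  show ?thesis using False *[of v] *[of "-v"] by (cases "v \<ge> 0") auto
qed

lemma ker_1_le: "ker 1 v \<le> 8 / (1 + v\<^sup>2)"
proof (cases "v\<^sup>2 \<le> 1")
  case True
  have "ker 1 v \<le> 1 / 3" using ker_le_cube[of 1 v] by simp
  also have "\<dots> \<le> 8 / (1 + v\<^sup>2)" using True by (simp add: field_simps add_pos_nonneg)
  finally show ?thesis .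
next
  case False
  hence v: "v \<noteq> 0" by auto
  have "ker 1 v \<le> 4 / v\<^sup>2" using ker_le_inverse_square[of 1 v] v by simp
  also have "\<dots> \<le> 8 / (1 + v\<^sup>2)" using False v by (simp add: field_simps add_pos_nonneg)
  finally show ?thesis .
qed

section \<open>Comparing the smoothed sums of mangoldt n / n and of 1 / n\<close>

text \<open>One integration by parts against \<open>exp (i u t)\<close>: the two boundary terms
  contribute \<open>2 B / u\<close> and the integral of the derivative at most
  \<open>B' T / u\<close>.\<close>

lemma oscillatory_integral_bound:
  fixes W W' :: "real \<Rightarrow> complex"
  assumes T: "T \<ge> 0" and u: "u > 0"
    and W: "\<And>t. t \<in> {0..T} \<Longrightarrow> (W has_vector_derivative W' t) (at t within {0..T})"
    and B: "\<And>t. t \<in> {0..T} \<Longrightarrow> norm (W t) \<le> B" and B': "\<And>t. t \<in> {0..T} \<Longrightarrow> norm (W' t) \<le> B'"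
  obtains J where "((\<lambda>t. W t * exp (\<i> * of_real (u * t))) has_integral J) {0..T}"
    "norm J \<le> (2 * B + B' * T) / u"
proof -
  let ?e = "\<lambda>t. exp (\<i> * of_real (u * t)) :: complex"
  have cont: "continuous_on {0..T} W"
    using has_vector_derivative_continuous[OF W] by (auto simp: continuous_on_eq_continuous_within)
  hence "(\<lambda>t. W t * ?e t) integrable_on {0..T}"
    by (intro integrable_continuous_real continuous_intros)
  then obtain J where J: "((\<lambda>t. W t * ?e t) has_integral J) {0..T}" by blast
  define D where "D = W T * (?e T / (\<i> * of_real u)) - W 0 * (?e 0 / (\<i> * of_real u))"
  have "((\<lambda>t. W t * ?e t + W' t * (?e t / (\<i> * of_real u))) has_integral D) {0..T}"
    unfolding D_def
  proof (rule fundamental_theorem_of_calculus[OF T])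
    fix t assume t: "t \<in> {0..T}"
    have "((\<lambda>z. exp (\<i> * of_real u * z) / (\<i> * of_real u)) has_field_derivative exp (\<i> * of_real u * of_real t)) (at (of_real t))"
      using u by (auto intro!: derivative_eq_intros)
    hence "((\<lambda>t. exp (\<i> * of_real u * of_real t) / (\<i> * of_real u)) has_vector_derivative exp (\<i> * of_real u * of_real t)) (at t within {0..T})"
      by (intro has_vector_derivative_real_field[unfolded o_def] has_vector_derivative_at_within)
    hence "((\<lambda>t. ?e t / (\<i> * of_real u)) has_vector_derivative ?e t) (at t within {0..T})"
      by (simp add: mult.assoc)
    from has_vector_derivative_mult[OF W[OF t] this]
    show "((\<lambda>t. W t * (?e t / (\<i> * of_real u))) has_vector_derivative W t * ?e t + W' t * (?e t / (\<i> * of_real u))) (at t within {0..T})"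
      by (simp add: algebra_simps)
  qed
  from has_integral_diff[OF this J]
  have I: "((\<lambda>t. W' t * (?e t / (\<i> * of_real u))) has_integral (D - J)) {0..T}" by simp
  have ne: "norm (?e t) = 1" for t by (simp add: norm_exp_i_times[simplified])
  have "norm (D - J) \<le> (B' / u) * measure lborel (cbox 0 T)"
  proof (rule has_integral_bound)
    show "0 \<le> B' / u" using order_trans[OF norm_ge_zero B'[of 0]] T u by (intro divide_nonneg_pos) auto
    show "((\<lambda>t. W' t * (?e t / (\<i> * of_real u))) has_integral (D - J)) (cbox 0 T)" using I by simp
    fix t assume "t \<in> cbox 0 T"
    thus "norm (W' t * (?e t / (\<i> * of_real u))) \<le> B' / u"
      using B'[of t] u by (simp add: norm_mult norm_divide ne divide_right_mono)
  qed
  moreover have "norm D \<le> B / u + B / u"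
    unfolding D_def
  proof (rule order_trans[OF norm_triangle_ineq4 add_mono])
    show "norm (W T * (?e T / (\<i> * of_real u))) \<le> B / u" "norm (W 0 * (?e 0 / (\<i> * of_real u))) \<le> B / u"
      using B[of T] B[of 0] T u by (simp_all add: norm_mult norm_divide ne divide_right_mono)
  qed
  moreover have "norm J \<le> norm D + norm (D - J)" using norm_triangle_ineq4[of D "D - J"] by simp
  moreover have "(2 * B + B' * T) / u = B / u + B / u + B' / u * T" by (simp add: add_divide_distrib)
  ultimately have "norm J \<le> (2 * B + B' * T) / u" using T by simp
  with J that show ?thesis by blast
qed

lemma ksum_summable:
  assumes "\<delta> > 0" "T \<ge> 0"
  shows "summable (\<lambda>n. mangoldt n * (real n powr (-(1 + \<delta>)) * ker T (ln (real n) - u)))"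
    and "summable (\<lambda>n. real n powr (-(1 + \<delta>)) * ker T (ln (real n) - u))"
proof -
  show "summable (\<lambda>n. real n powr (-(1 + \<delta>)) * ker T (ln (real n) - u))"
  proof (rule summable_comparison_test_ev[OF eventually_sequentiallyI[of 0]])
    show "summable (\<lambda>n. real n powr (-(1 + \<delta>)) * (T ^ 3 / 3))"
      using assms by (intro summable_mult2) (simp add: summable_real_powr_iff)
    show "norm (real n powr (-(1 + \<delta>)) * ker T (ln (real n) - u)) \<le> real n powr (-(1 + \<delta>)) * (T ^ 3 / 3)" for n
      using mult_left_mono[OF ker_le_cube[OF assms(2), of "ln (real n) - u"], of "real n powr (-(1 + \<delta>))"]
        ker_nonneg[OF assms(2)] by (simp add: abs_mult)
  qed
  show "summable (\<lambda>n. mangoldt n * (real n powr (-(1 + \<delta>)) * ker T (ln (real n) - u)))"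
  proof (rule summable_comparison_test_ev[OF eventually_sequentiallyI[of 0]])
    show "summable (\<lambda>n. ln (real n) * real n powr (-(1 + \<delta>)) * (T ^ 3 / 3))"
      using assms by (intro summable_mult2 summable_log_powr) simp
    fix n :: nat
    have "mangoldt n * (real n powr (-(1 + \<delta>)) * ker T (ln (real n) - u)) \<le> ln (real n) * (real n powr (-(1 + \<delta>)) * (T ^ 3 / 3))"
      using ker_le_cube[OF assms(2)] ker_nonneg[OF assms(2)] mangoldt_le_ln[of n] mangoldt_nonneg[of n]
      by (intro mult_mono) (auto intro: order_trans)
    thus "norm (mangoldt n * (real n powr (-(1 + \<delta>)) * ker T (ln (real n) - u))) \<le> ln (real n) * real n powr (-(1 + \<delta>)) * (T ^ 3 / 3)"
      using ker_nonneg[OF assms(2)] mangoldt_nonneg[of n] by (simp add: abs_mult mult.assoc)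
  qed
qed

text \<open>Integrating the real part of \<open>lseries - zeta\<close> on the line
  \<open>1 + \<delta> + i t\<close> against \<open>(T - t)^2 exp (i u t)\<close> produces the
  difference of the two sums term by term, and the oscillation makes it O(1/u). The constant may
  depend on \<open>T\<close>, but neither on \<open>u\<close> nor on
  \<open>\<delta>\<close>.\<close>

lemma ksum_difference:
  assumes T: "T > 0"
  obtains C where "\<And>u \<delta>. u > 0 \<Longrightarrow> 0 < \<delta> \<Longrightarrow> \<delta> \<le> 1 \<Longrightarrow>
     \<bar>(\<Sum>n. mangoldt n * (real n powr (-(1 + \<delta>)) * ker T (ln (real n) - u))) -
      (\<Sum>n. real n powr (-(1 + \<delta>)) * ker T (ln (real n) - u))\<bar> \<le> C / u"
proof -
  obtain U where U: "open U" "{s. Re s \<ge> 1} \<subseteq> U" "lseries_minus_zeta holomorphic_on U" by (rule lseries_minus_zeta_holomorphic)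
  \<comment> \<open>This compact rectangle contains every segment \<open>1 + \<delta> + i t\<close>
    that occurs and reaches the line Re s = 1, so bounds on it do not depend on
    \<open>\<delta>\<close>.\<close>
  let ?K = "cbox (Complex 1 0) (Complex 2 T)"
  have K: "?K \<subseteq> U" using U(2) by (auto simp: in_cbox_complex_iff)
  have "bounded (lseries_minus_zeta ` ?K)" "bounded (deriv lseries_minus_zeta ` ?K)"
    using continuous_on_subset[OF holomorphic_on_imp_continuous_on[OF U(3)] K]
      continuous_on_subset[OF holomorphic_on_imp_continuous_on[OF holomorphic_deriv[OF U(3,1)]] K]
    by (auto intro!: compact_imp_bounded compact_continuous_image)
  then obtain B1 B2 where B12: "\<And>s. s \<in> ?K \<Longrightarrow> norm (lseries_minus_zeta s) \<le> B1" "\<And>s. s \<in> ?K \<Longrightarrow> norm (deriv lseries_minus_zeta s) \<le> B2"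
    by (auto simp: bounded_iff)
  define B where "B = max 0 (max B1 B2)"
  have B: "\<And>s. s \<in> ?K \<Longrightarrow> norm (lseries_minus_zeta s) \<le> B" "\<And>s. s \<in> ?K \<Longrightarrow> norm (deriv lseries_minus_zeta s) \<le> B" "B \<ge> 0"
    using B12 by (force simp: B_def)+
  define C where "C = 2 * (T\<^sup>2 * B) + (2 * T * B + T\<^sup>2 * B) * T"
  show ?thesis
  proof (rule that)
    fix u \<delta> :: real assume u: "u > 0" and \<delta>: "0 < \<delta>" "\<delta> \<le> 1"
    define s where "s = (\<lambda>t. Complex (1 + \<delta>) t)"
    have s_eq: "s t = of_real (1 + \<delta>) + of_real t * \<i>" for t by (simp add: s_def complex_eq_iff)
    have sK: "s t \<in> ?K" if "t \<in> {0..T}" for t using that \<delta> by (auto simp: s_def in_cbox_complex_iff)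
    define W where "W = (\<lambda>t. of_real ((T - t)\<^sup>2) * lseries_minus_zeta (s t))"
    define W' where "W' = (\<lambda>t. of_real ((T - t)\<^sup>2) * (\<i> * deriv lseries_minus_zeta (s t)) + of_real (- 2 * (T - t)) * lseries_minus_zeta (s t))"
    have W: "(W has_vector_derivative W' t) (at t within {0..T})" if "t \<in> {0..T}" for t
    proof -
      have "(lseries_minus_zeta has_field_derivative deriv lseries_minus_zeta (s t)) (at (s t))"
        using sK[OF that] K U by (auto intro!: holomorphic_derivI[OF U(3,1)])
      moreover have "(s has_vector_derivative \<i>) (at t within {0..T})"
        unfolding s_eq[abs_def] by (auto intro!: derivative_eq_intros)
      ultimately have "((lseries_minus_zeta \<circ> s) has_vector_derivative \<i> * deriv lseries_minus_zeta (s t)) (at t within {0..T})"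
        by (rule field_vector_diff_chain_within[rotated, OF has_field_derivative_at_within])
      hence 1: "((\<lambda>t. lseries_minus_zeta (s t)) has_vector_derivative \<i> * deriv lseries_minus_zeta (s t)) (at t within {0..T})" by (simp add: o_def)
      have "((\<lambda>t. (T - t)\<^sup>2) has_real_derivative (- 2 * (T - t))) (at t within {0..T})"
        by (auto intro!: derivative_eq_intros)
      hence "((\<lambda>t. complex_of_real ((T - t)\<^sup>2)) has_vector_derivative of_real (- 2 * (T - t))) (at t within {0..T})"
        by (intro has_vector_derivative_of_real) (simp only: has_real_derivative_iff_has_vector_derivative)
      from has_vector_derivative_mult[OF this 1] show ?thesis by (simp add: W_def W'_def)
    qed
    have sq: "(T - t)\<^sup>2 \<le> T\<^sup>2" if "t \<in> {0..T}" for t using that by (intro power_mono) auto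
    have bW: "norm (W t) \<le> T\<^sup>2 * B" if "t \<in> {0..T}" for t
      unfolding W_def norm_mult norm_of_real
      using sq[OF that] B(1)[OF sK[OF that]] B(3) by (intro mult_mono) auto
    have bW': "norm (W' t) \<le> 2 * T * B + T\<^sup>2 * B" if "t \<in> {0..T}" for t
    proof -
      have "norm (W' t) \<le> (T - t)\<^sup>2 * norm (deriv lseries_minus_zeta (s t)) + 2 * (T - t) * norm (lseries_minus_zeta (s t))"
        unfolding W'_def using that
        by (intro order_trans[OF norm_triangle_ineq]) (simp add: norm_mult norm_power flip: of_real_diff)
      also have "\<dots> \<le> T\<^sup>2 * B + 2 * T * B"
        using sq[OF that] B(1,2)[OF sK[OF that]] B(3) that T by (intro add_mono mult_mono) auto
      finally show ?thesis by simp
    qed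
    obtain J where J: "((\<lambda>t. W t * exp (\<i> * of_real (u * t))) has_integral J) {0..T}"
      "norm J \<le> (2 * (T\<^sup>2 * B) + (2 * T * B + T\<^sup>2 * B) * T) / u"
      using oscillatory_integral_bound[OF less_imp_le[OF T] u W bW bW'] by blast
    have ReJ: "((\<lambda>t. Re (W t * exp (\<i> * of_real (u * t)))) has_integral Re J) {0..T}"
      using has_integral_Re[OF J(1)] by simp

    define c where "c = (\<lambda>n. (mangoldt n - 1) * real n powr (-(1 + \<delta>)))"
    \<comment> \<open>The real part of the \<open>n\<close>-th term of the integrand; its integral
      over \<open>{0..T}\<close> is \<open>c n * ker T (ln n - u)\<close>.\<close>
    define f where "f = (\<lambda>n t. c n * ((T - t)\<^sup>2 * cos (t * (ln (real n) - u))))"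
    have lim: "(\<Sum>n. f n t) = Re (W t * exp (\<i> * of_real (u * t)))" for t
    proof -
      have gt: "Re (s t) > 1" using \<delta> by (simp add: s_def)
      have "(\<lambda>n. (mangoldt n * of_nat n powr (- s t) - of_nat n powr (- s t)) * (of_real ((T - t)\<^sup>2) * exp (\<i> * of_real (u * t)))) sums
         ((lseries (s t) - zeta (s t)) * (of_real ((T - t)\<^sup>2) * exp (\<i> * of_real (u * t))))"
        by (intro sums_mult2 sums_diff lseries_sums[OF gt] zeta_series(1)[OF gt])
      also have "(lseries (s t) - zeta (s t)) * (of_real ((T - t)\<^sup>2) * exp (\<i> * of_real (u * t))) = W t * exp (\<i> * of_real (u * t))"
        using lseries_minus_zeta_eq[OF gt] by (simp add: W_def)
      finally have "(\<lambda>n. Re ((mangoldt n * of_nat n powr (- s t) - of_nat n powr (- s t)) * (of_real ((T - t)\<^sup>2) * exp (\<i> * of_real (u * t))))) sums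
          Re (W t * exp (\<i> * of_real (u * t)))" by (rule sums_Re)
      moreover have "Re ((mangoldt n * of_nat n powr (- s t) - of_nat n powr (- s t)) * (of_real ((T - t)\<^sup>2) * exp (\<i> * of_real (u * t)))) = f n t" for n
      proof (cases "n = 0")
        case False
        have "of_nat n powr (- s t) * exp (\<i> * of_real (u * t)) = exp (- s t * of_real (ln (real n)) + \<i> * of_real (u * t))"
          unfolding exp_add using False by (simp add: powr_def Ln_of_nat)
        also have "- s t * of_real (ln (real n)) + \<i> * of_real (u * t) = Complex (- (1 + \<delta>) * ln (real n)) (t * (u - ln (real n)))"
          by (simp add: s_def complex_eq_iff algebra_simps)
        finally have "Re (of_nat n powr (- s t) * exp (\<i> * of_real (u * t))) = exp (- (1 + \<delta>) * ln (real n)) * cos (t * (u - ln (real n)))"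
          by (simp add: Re_exp)
        also have "exp (- (1 + \<delta>) * ln (real n)) = real n powr (- (1 + \<delta>))" using False by (simp add: powr_def)
        also have "cos (t * (u - ln (real n))) = cos (t * (ln (real n) - u))"
          by (metis cos_minus minus_diff_eq mult_minus_right)
        finally have r1: "Re (of_nat n powr (- s t) * exp (\<i> * of_real (u * t))) = real n powr (- (1 + \<delta>)) * cos (t * (ln (real n) - u))" .
        have r2: "(mangoldt n * of_nat n powr (- s t) - of_nat n powr (- s t)) * (of_real ((T - t)\<^sup>2) * exp (\<i> * of_real (u * t)))
           = of_real ((mangoldt n - 1) * (T - t)\<^sup>2) * (of_nat n powr (- s t) * exp (\<i> * of_real (u * t)))"
          by (simp add: algebra_simps)
        show ?thesis
          unfolding r2 unfolding scaleR_conv_of_real[symmetric] scaleR_complex.sel unfolding r1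
          by (simp add: f_def c_def)
      qed (auto simp: f_def c_def)
      ultimately show ?thesis by (simp add: sums_iff)
    qed
    \<comment> \<open>Uniform convergence, which \<open>\<delta> > 0\<close> provides, justifies
      integrating the series termwise.\<close>
    have unif: "uniform_limit {0..T} (\<lambda>N t. \<Sum>n<N. f n t) (\<lambda>t. \<Sum>n. f n t) sequentially"
    proof (rule Weierstrass_m_test)
      show "summable (\<lambda>n. (ln (real n) * real n powr (-(1 + \<delta>)) + real n powr (-(1 + \<delta>))) * T\<^sup>2)"
        using \<delta> by (intro summable_mult2 summable_add summable_log_powr) (simp_all add: summable_real_powr_iff)
      fix n t assume t: "t \<in> {0..T}"
      have "\<bar>(mangoldt n - 1) * real n powr (-(1 + \<delta>))\<bar> \<le> ln (real n) * real n powr (-(1 + \<delta>)) + real n powr (-(1 + \<delta>))"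
      proof -
        have "\<bar>mangoldt n - 1\<bar> \<le> ln (real n) + 1" using mangoldt_le_ln[of n] mangoldt_nonneg[of n] by linarith
        hence "\<bar>mangoldt n - 1\<bar> * real n powr (-(1 + \<delta>)) \<le> (ln (real n) + 1) * real n powr (-(1 + \<delta>))"
          by (intro mult_right_mono) auto
        thus ?thesis by (simp add: abs_mult distrib_right)
      qed
      moreover have "\<bar>(T - t)\<^sup>2 * cos (t * (ln (real n) - u))\<bar> \<le> T\<^sup>2 * 1"
        unfolding abs_mult using sq[OF t] by (intro mult_mono) auto
      ultimately show "norm (f n t) \<le> (ln (real n) * real n powr (-(1 + \<delta>)) + real n powr (-(1 + \<delta>))) * T\<^sup>2"
        unfolding f_def c_def real_norm_def abs_mult[of "(mangoldt n - 1) * _"] by (intro mult_mono) auto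
    qed
    have I: "((\<lambda>t. \<Sum>n<N. f n t) has_integral (\<Sum>n<N. c n * ker T (ln (real n) - u))) {0..T}" for N
      unfolding f_def using T by (intro has_integral_sum has_integral_mult_right has_integral_ker) auto
    have "continuous_on {0..T} (\<lambda>t. \<Sum>n<N. f n t)" for N
      unfolding f_def by (intro continuous_intros)
    from uniform_limit_integral[OF unif this] obtain I' J' where
      I': "\<And>N. ((\<lambda>t. \<Sum>n<N. f n t) has_integral I' N) {0..T}" "((\<lambda>t. \<Sum>n. f n t) has_integral J') {0..T}" "I' \<longlonglongrightarrow> J'"
      by auto
    have "I' = (\<lambda>N. \<Sum>n<N. c n * ker T (ln (real n) - u))" using has_integral_unique[OF I'(1) I] by (rule ext)
    moreover have "J' = Re J" using has_integral_unique[OF I'(2)] ReJ lim by simp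
    ultimately have "(\<lambda>n. c n * ker T (ln (real n) - u)) sums Re J" using I'(3) by (simp add: sums_def)
    moreover have "(\<lambda>n. c n * ker T (ln (real n) - u)) sums
       ((\<Sum>n. mangoldt n * (real n powr (-(1 + \<delta>)) * ker T (ln (real n) - u))) -
        (\<Sum>n. real n powr (-(1 + \<delta>)) * ker T (ln (real n) - u)))"
      using sums_diff[OF summable_sums[OF ksum_summable(1)[of \<delta> T u]] summable_sums[OF ksum_summable(2)[of \<delta> T u]]] \<delta> T
      by (simp add: c_def algebra_simps)
    ultimately have "Re J = (\<Sum>n. mangoldt n * (real n powr (-(1 + \<delta>)) * ker T (ln (real n) - u))) -
        (\<Sum>n. real n powr (-(1 + \<delta>)) * ker T (ln (real n) - u))" by (rule sums_unique2)
    moreover have "\<bar>Re J\<bar> \<le> C / u" using J(2) abs_Re_le_cmod[of J] unfolding C_def by linarith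
    ultimately show "\<bar>(\<Sum>n. mangoldt n * (real n powr (-(1 + \<delta>)) * ker T (ln (real n) - u))) -
        (\<Sum>n. real n powr (-(1 + \<delta>)) * ker T (ln (real n) - u))\<bar> \<le> C / u" by simp
  qed
qed

section \<open>Primes in short intervals\<close>

text \<open>Bounds the smoothed sum of \<open>1 / n\<close> by a telescoping sum.\<close>

lemma arctan_ln_step:
  assumes "n \<ge> (2::nat)"
  shows "1 / (real n * (1 + (ln (real n) - u)\<^sup>2)) \<le> 3 * (arctan (ln (real n) - u) - arctan (ln (real n - 1) - u))"
proof -
  let ?f = "\<lambda>x. arctan (ln x - u)"
  have der: "(?f has_real_derivative (1 / (x * (1 + (ln x - u)\<^sup>2)))) (at x)" if "x \<ge> real n - 1" for x
    using that assms by (auto intro!: derivative_eq_intros simp: field_simps)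
  have "real n - 1 < real n" by simp
  from MVT2[OF this, of ?f, OF der] obtain z where z: "z > real n - 1" "z < real n"
    "?f (real n) - ?f (real n - 1) = (real n - (real n - 1)) * (1 / (z * (1 + (ln z - u)\<^sup>2)))" by auto
  have z0: "z > 0" using z(1) assms by simp
  have "ln (real n) - ln z \<le> real n / z - 1"
    using z z0 assms ln_le_minus_one[of "real n / z"] by (simp add: ln_div)
  also have "\<dots> = (real n - z) / z" using z0 by (simp add: field_simps)
  also have "\<dots> \<le> 1" using z z0 assms by (simp add: field_simps)
  finally have d: "\<bar>ln (real n) - ln z\<bar> \<le> 1" using z z0 by simp
  \<comment> \<open>The parallelogram inequality. As \<open>ln n\<close> and \<open>ln z\<close>
    differ by at most 1, replacing one by the other costs at most a factor 3.\<close>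
  have v: "(ln z - u)\<^sup>2 \<le> 2 * (ln (real n) - u)\<^sup>2 + 2 * (ln (real n) - ln z)\<^sup>2"
    using zero_le_power2[of "(ln (real n) - u) + (ln (real n) - ln z)"] by (simp add: power2_eq_square algebra_simps)
  have "(ln (real n) - ln z)\<^sup>2 \<le> 1" using d by (simp add: abs_square_le_1)
  moreover have "1 + Z \<le> 3 * (1 + V)" if "Z \<le> 2 * V + 2 * W" "W \<le> 1" "0 \<le> V" for Z V W :: real
    using that by (simp add: distrib_left)
  ultimately have "1 + (ln z - u)\<^sup>2 \<le> 3 * (1 + (ln (real n) - u)\<^sup>2)" using v zero_le_power2 by blast
  hence "z * (1 + (ln z - u)\<^sup>2) \<le> real n * (3 * (1 + (ln (real n) - u)\<^sup>2))"
    using z z0 by (intro mult_mono) auto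
  also have "\<dots> = 3 * (real n * (1 + (ln (real n) - u)\<^sup>2))" by (rule mult.left_commute)
  finally have le: "z * (1 + (ln z - u)\<^sup>2) \<le> 3 * (real n * (1 + (ln (real n) - u)\<^sup>2))" .
  have pos: "z * (1 + (ln z - u)\<^sup>2) > 0" "real n * (1 + (ln (real n) - u)\<^sup>2) > 0"
    using z0 assms by (auto intro!: mult_pos_pos add_pos_nonneg)
  have "1 / b \<le> 3 * (1 / a)" if "a \<le> 3 * b" "a > 0" "b > 0" for a b :: real
    using that by (simp add: field_simps)
  from this[OF le pos] show ?thesis unfolding z(3) by simp
qed

text \<open>The terms from index 2 on are dominated by increments of
  \<open>24 * arctan (ln x - u)\<close>, whose total variation is at most \<open>24 pi\<close>; the
  8 accounts for index 1. The bound is uniform in \<open>u\<close> and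
  \<open>\<delta>\<close>.\<close>

lemma ksum_one_le:
  assumes "\<delta> > 0"
  shows "(\<Sum>n. real n powr (-(1 + \<delta>)) * ker 1 (ln (real n) - u)) \<le> 8 + 24 * pi"
proof (rule suminf_le_const)
  show "summable (\<lambda>n. real n powr (-(1 + \<delta>)) * ker 1 (ln (real n) - u))"
    using ksum_summable(2)[OF assms, of 1] by simp
  define t where "t = (\<lambda>n::nat. real n powr (-(1 + \<delta>)) * ker 1 (ln (real n) - u))"
  define A where "A = (\<lambda>x. arctan (ln x - u))"
  have t0: "t n \<ge> 0" for n using ker_nonneg[of 1] by (simp add: t_def)
  have t1: "t n \<le> 8 / (real n * (1 + (ln (real n) - u)\<^sup>2))" if "n \<ge> 1" for n
  proof -
    have "real n powr (-(1 + \<delta>)) \<le> real n powr (-1)" using that assms by (intro powr_mono) auto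
    hence "t n \<le> real n powr (-1) * (8 / (1 + (ln (real n) - u)\<^sup>2))"
      unfolding t_def using ker_1_le ker_nonneg[of 1] by (intro mult_mono) auto
    thus ?thesis using that by (simp add: powr_minus_divide)
  qed
  have "(\<Sum>n<N + 2. t n) \<le> 8 + 24 * (A (real (N + 1)) - A 1)" for N
  proof (induction N)
    case 0
    have "t 1 \<le> 8 / (1 * (1 + (ln 1 - u)\<^sup>2))" using t1[of 1] by simp
    also have "\<dots> \<le> 8" by (simp add: field_simps add_pos_nonneg)
    finally have "t 1 \<le> 8" .
    thus ?case by (simp add: numeral_2_eq_2 t_def)
  next
    case (Suc N)
    have "t (N + 2) \<le> 8 / (real (N + 2) * (1 + (ln (real (N + 2)) - u)\<^sup>2))" by (rule t1) simp
    also have "\<dots> \<le> 24 * (A (real (N + 2)) - A (real (N + 1)))"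
      using arctan_ln_step[of "N + 2" u] by (simp add: A_def add_ac)
    finally show ?case using Suc.IH by (simp add: add_ac)
  qed
  moreover have "A x - A y \<le> pi" for x y
    using arctan_bounded[of "ln x - u"] arctan_bounded[of "ln y - u"] by (simp add: A_def)
  ultimately have "(\<Sum>n<N + 2. t n) \<le> 8 + 24 * pi" for N by (smt (verit, best))
  moreover have "(\<Sum>n<N. t n) \<le> (\<Sum>n<N + 2. t n)" for N
    using t0 by (intro sum_mono2) auto
  ultimately show "(\<Sum>n<N. real n powr (-(1 + \<delta>)) * ker 1 (ln (real n) - u)) \<le> 8 + 24 * pi" for N
    unfolding t_def by (meson order_trans)
qed

text \<open>With \<open>x = exp u\<close>, there are at least \<open>x / (2 T)\<close> integers
  between \<open>x\<close> and \<open>x + x / T\<close>. For them \<open>ln n\<close> is within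
  \<open>1 / T\<close> of \<open>u\<close>, so the kernel has size at least \<open>T^3 / 6\<close>,
  while each weight is of order \<open>1 / x\<close>.\<close>

lemma ksum_ge:
  assumes T: "T \<ge> 1" and u: "u \<ge> 1" and uT: "exp u \<ge> 2 * T"
  shows "(\<Sum>n. real n powr (-(1 + 1 / u)) * ker T (ln (real n) - u)) \<ge> exp (-2) / 24 * T\<^sup>2"
proof -
  define x where "x = exp u"
  have x: "x \<ge> 2 * T" "x > 0" "x \<ge> 2" using uT T by (auto simp: x_def)
  define M where "M = {nat \<lceil>x\<rceil>..nat \<lfloor>x + x / T\<rfloor>}"
  have M: "x \<le> real n \<and> real n \<le> x + x / T" if "n \<in> M" for n
    using that x T unfolding M_def by (auto simp: nat_le_iff le_nat_iff le_floor_iff ceiling_le_iff)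
  have "x / T \<ge> 2" using x T by (simp add: field_simps)
  \<comment> \<open>Rounding at both ends costs at most 1, which is half of \<open>x / T\<close> or
    less because \<open>x / T\<close> is at least 2.\<close>
  have cardM: "real (card M) \<ge> x / (2 * T)"
  proof -
    have "real (card M) \<ge> real (nat \<lfloor>x + x / T\<rfloor>) + 1 - real (nat \<lceil>x\<rceil>)"
      unfolding M_def by simp
    moreover have "real (nat \<lfloor>x + x / T\<rfloor>) \<ge> x + x / T - 1" by linarith
    moreover have "real (nat \<lceil>x\<rceil>) \<le> x + 1" using x by linarith
    moreover have "x / (2 * T) = x / T / 2" by simp
    ultimately show ?thesis using \<open>x / T \<ge> 2\<close> by linarith
  qed
  have summand: "real n powr (-(1 + 1 / u)) * ker T (ln (real n) - u) \<ge> exp (-2) / (2 * x) * (T ^ 3 / 6)" if n: "n \<in> M" for n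
  proof (intro mult_mono)
    have nx: "x \<le> real n" "real n \<le> x + x / T" using M[OF n] by auto
    hence n0: "real n > 0" using x by linarith
    have "x / T \<le> x" using T x by (simp add: field_simps)
    hence n2: "real n \<le> 2 * x" using nx by linarith
    \<comment> \<open>This is where \<open>\<delta> = 1 / u\<close> pays off: on numbers up to
      \<open>2 * exp u\<close> the factor \<open>n powr (- 1 / u)\<close> is at least
      \<open>exp (-2)\<close>.\<close>
    have "exp (-2) / (2 * x) \<le> (2 * x) powr (-(1 + 1 / u))"
    proof -
      have "(2 * x) powr (-(1 + 1 / u)) = (2 * x) powr (-1) * (2 * x) powr (- (1 / u))"
        unfolding powr_add[symmetric] by simp
      also have "(2 * x) powr (- (1 / u)) = exp (- ((ln 2 + u) / u))" using x
        by (simp add: powr_def ln_mult x_def)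
      also have "(2 * x) powr (-1) = 1 / (2 * x)" using x by (simp add: powr_minus_divide)
      finally have eq: "(2 * x) powr (-(1 + 1 / u)) = 1 / (2 * x) * exp (- ((ln 2 + u) / u))" .
      have "ln 2 \<le> (1::real)" using ln_2_less_1 by simp
      hence "(ln 2 + u) / u \<le> 2" using u by (simp add: field_simps)
      hence "exp (-2) \<le> exp (- ((ln 2 + u) / u))" by (subst exp_le_cancel_iff) (simp only: neg_le_iff_le)
      hence "1 / (2 * x) * exp (-2) \<le> 1 / (2 * x) * exp (- ((ln 2 + u) / u))" using x by (intro mult_left_mono) auto
      thus ?thesis unfolding eq by simp
    qed
    also have "\<dots> \<le> real n powr (-(1 + 1 / u))" using n2 n0 u by (intro powr_mono2') (auto intro: order_trans[of _ 0])
    finally show "exp (-2) / (2 * x) \<le> real n powr (-(1 + 1 / u))" .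
    have "ln (real n) - u = ln (real n / x)" using n0 x by (simp add: ln_div x_def)
    moreover have "ln (real n / x) \<ge> 0" using nx x by simp
    moreover have "ln (real n / x) \<le> real n / x - 1" using n0 x by (intro ln_le_minus_one) simp
    moreover have "real n / x - 1 \<le> 1 / T" using nx x T by (simp add: field_simps)
    ultimately have "\<bar>ln (real n) - u\<bar> \<le> 1 / T" by simp
    hence "T * \<bar>ln (real n) - u\<bar> \<le> T * (1 / T)" using T by (intro mult_left_mono) auto
    hence "T * \<bar>ln (real n) - u\<bar> \<le> pi / 3" using T pi_gt3 by simp
    thus "T ^ 3 / 6 \<le> ker T (ln (real n) - u)" using T by (intro ker_ge_cube) auto
  qed (use T in auto)
  have "exp (-2) / 24 * T\<^sup>2 = x / (2 * T) * (exp (-2) / (2 * x) * (T ^ 3 / 6))"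
    using x T by (simp add: field_simps power2_eq_square power3_eq_cube)
  also have "\<dots> \<le> real (card M) * (exp (-2) / (2 * x) * (T ^ 3 / 6))"
    using cardM x T by (intro mult_right_mono) auto
  also have "\<dots> = (\<Sum>n\<in>M. exp (-2) / (2 * x) * (T ^ 3 / 6))" by simp
  also have "\<dots> \<le> (\<Sum>n\<in>M. real n powr (-(1 + 1 / u)) * ker T (ln (real n) - u))" by (intro sum_mono summand)
  also have "\<dots> \<le> (\<Sum>n. real n powr (-(1 + 1 / u)) * ker T (ln (real n) - u))"
    using T u ker_nonneg[of T] ksum_summable(2)[of "1 / u" T u] by (intro sum_le_suminf) (auto simp: M_def)
  finally show ?thesis .
qed

section \<open>From prime powers to primes\<close>

text \<open>The exponent is at least 2, so the base is at most \<open>sqrt y\<close>, and the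
  exponent is at most \<open>2 ln y\<close>. Hence proper prime powers are too rare to
  matter.\<close>

lemma card_proper_prime_powers_le:
  assumes y: "y \<ge> (1::real)"
  shows "finite {n. primepow n \<and> \<not> prime n \<and> real n \<le> y}"
    and "real (card {n. primepow n \<and> \<not> prime n \<and> real n \<le> y}) \<le> 2 * sqrt y * (2 * ln y + 1)"
proof -
  let ?S = "{n::nat. primepow n \<and> \<not> prime n \<and> real n \<le> y}"
  let ?P = "{1..nat \<lfloor>sqrt y\<rfloor>}" and ?Q = "{1..nat \<lfloor>2 * ln y\<rfloor>}"
  have sub: "?S \<subseteq> (\<lambda>(p, k). p ^ k) ` (?P \<times> ?Q)"
  proof
    fix n assume n: "n \<in> ?S"
    then obtain p k where pk: "prime p" "k > 0" "n = p ^ k" by (auto simp: primepow_def)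
    have k: "k \<ge> 2" using pk n by (cases "k = 1") auto
    have "p ^ 2 \<le> n" unfolding pk(3) using pk(1) k by (intro power_increasing) (auto simp: prime_gt_0_nat Suc_le_eq)
    hence "(real p)\<^sup>2 \<le> y" using n by (metis (mono_tags, lifting) mem_Collect_eq of_nat_le_iff of_nat_power order_trans)
    hence p: "real p \<le> sqrt y" by (rule real_le_rsqrt)
    have "2 ^ k \<le> n" unfolding pk(3) using prime_ge_2_nat[OF pk(1)] by (intro power_mono) auto
    hence "2 ^ k \<le> y" using n by (metis (mono_tags, lifting) mem_Collect_eq of_nat_le_iff of_nat_numeral of_nat_power order_trans)
    hence "ln (2 ^ k) \<le> ln y" using y by (subst ln_le_cancel_iff) auto
    hence "real k * ln 2 \<le> ln y" by (simp add: ln_realpow)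
    moreover have "real k * (1 / 2) \<le> real k * ln 2" using ln2_ge_two_thirds by (intro mult_left_mono) auto
    ultimately have "real k \<le> 2 * ln y" by linarith
    hence "(p, k) \<in> ?P \<times> ?Q" using p pk prime_gt_0_nat[OF pk(1)] by (auto simp: Suc_le_eq intro!: le_nat_floor)
    thus "n \<in> (\<lambda>(p, k). p ^ k) ` (?P \<times> ?Q)" using pk(3) by force
  qed
  show fin: "finite ?S" by (rule finite_subset[OF sub]) auto
  have "card ?S \<le> card ((\<lambda>(p, k). p ^ k) ` (?P \<times> ?Q))" by (rule card_mono[OF _ sub]) auto
  also have "\<dots> \<le> card (?P \<times> ?Q)" by (rule card_image_le) auto
  finally have "real (card ?S) \<le> real (nat \<lfloor>sqrt y\<rfloor>) * real (nat \<lfloor>2 * ln y\<rfloor>)"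
    by (simp flip: of_nat_mult)
  also have "\<dots> \<le> (2 * sqrt y) * (2 * ln y + 1)"
  proof (intro mult_mono)
    show "real (nat \<lfloor>sqrt y\<rfloor>) \<le> 2 * sqrt y" using y by (simp add: of_nat_nat) (smt (verit, best) of_int_floor_le real_sqrt_ge_zero)
    have "ln y \<ge> 0" using y by simp
    thus "real (nat \<lfloor>2 * ln y\<rfloor>) \<le> 2 * ln y + 1" by linarith
  qed (use y in auto)
  finally show "real (card ?S) \<le> 2 * sqrt y * (2 * ln y + 1)" by simp
qed

text \<open>By contradiction. If the window has no prime, the mangoldt sum for \<open>ker T\<close>
  is at most \<open>D * T\<close> plus a negligible share of proper prime powers: outside the window
  \<open>ker T\<close> is bounded by a multiple of \<open>T * ker 1\<close>, whose sum is bounded.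
  But the sum is at least \<open>c * T^2 - CT / u\<close>, which is impossible for a suitable fixed
  \<open>T\<close> and large \<open>u\<close>.\<close>

lemma prime_in_log_window:
  assumes \<epsilon>: "\<epsilon> > (0::real)"
  shows "\<forall>\<^sub>F u in at_top. \<exists>p::nat. prime p \<and> \<bar>ln (real p) - u\<bar> < \<epsilon>"
proof -
  obtain C0 where C0: "\<And>u \<delta>. u > 0 \<Longrightarrow> 0 < \<delta> \<Longrightarrow> \<delta> \<le> 1 \<Longrightarrow>
     \<bar>(\<Sum>n. mangoldt n * (real n powr (-(1 + \<delta>)) * ker 1 (ln (real n) - u))) -
      (\<Sum>n. real n powr (-(1 + \<delta>)) * ker 1 (ln (real n) - u))\<bar> \<le> C0 / u"
    using ksum_difference[of 1] by auto
  \<comment> \<open>80 is the 4 of \<open>ker_le_inverse_square\<close> times the 20 of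
    \<open>ker_1_ge\<close>; the last factor bounds the mangoldt sum for \<open>T = 1\<close>,
    through \<open>ksum_one_le\<close> and \<open>ksum_difference\<close>.\<close>
  define D where "D = 80 * (1 + 1 / \<epsilon>\<^sup>2) * (8 + 24 * pi + \<bar>C0\<bar>)"
  have D0: "D \<ge> 0" unfolding D_def by (intro mult_nonneg_nonneg add_nonneg_nonneg) auto
  define c where "c = exp (-2) / (24::real)"
  have c0: "c > 0" by (simp add: c_def)
  \<comment> \<open>Chosen so that \<open>c * T^2\<close> exceeds \<open>D * T\<close> by at least
    1. It is fixed before \<open>u\<close> tends to infinity, since \<open>CT\<close> depends on
    it.\<close>
  define T where "T = (D + 1) / c + 1"
  have T1: "T \<ge> 1" using D0 c0 by (simp add: T_def)
  have "c * T = D + 1 + c" using c0 by (simp add: T_def field_simps)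
  hence "c * T \<ge> D + 1" using c0 by simp
  hence "T * (c * T) \<ge> T * (D + 1)" using T1 by (intro mult_left_mono) auto
  hence T: "c * T\<^sup>2 \<ge> D * T + 1" using T1 by (simp add: power2_eq_square algebra_simps)
  obtain CT where CT: "\<And>u \<delta>. u > 0 \<Longrightarrow> 0 < \<delta> \<Longrightarrow> \<delta> \<le> 1 \<Longrightarrow>
     \<bar>(\<Sum>n. mangoldt n * (real n powr (-(1 + \<delta>)) * ker T (ln (real n) - u))) -
      (\<Sum>n. real n powr (-(1 + \<delta>)) * ker T (ln (real n) - u))\<bar> \<le> CT / u"
    using ksum_difference[of T] T1 by auto
  \<comment> \<open>The number of proper prime powers in the window times the largest possible value
    of \<open>mangoldt n * w n\<close> there; it decays like
    \<open>u^2 * exp (- u / 2)\<close>.\<close>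
  define E where "E = (\<lambda>u::real. 2 * exp ((u + \<epsilon>) / 2) * (2 * (u + \<epsilon>) + 1) * ((u + \<epsilon>) * exp (- (u - \<epsilon>))))"
  have "(E \<longlongrightarrow> 0) at_top" unfolding E_def by real_asymp
  moreover have "((\<lambda>u. CT / u) \<longlongrightarrow> 0) at_top" by real_asymp
  ultimately have "((\<lambda>u. T ^ 3 / 3 * E u + CT / u) \<longlongrightarrow> T ^ 3 / 3 * 0 + 0) at_top"
    by (intro tendsto_intros)
  hence "((\<lambda>u. T ^ 3 / 3 * E u + CT / u) \<longlongrightarrow> 0) at_top" by simp
  hence "\<forall>\<^sub>F u in at_top. T ^ 3 / 3 * E u + CT / u < 1" by (rule order_tendstoD) simp
  moreover have "\<forall>\<^sub>F u in at_top. u \<ge> max 1 (max \<epsilon> (ln (2 * T)))" by (rule eventually_ge_at_top)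
  ultimately show ?thesis
  proof eventually_elim
    case (elim u)
    hence u: "u \<ge> 1" "u \<ge> \<epsilon>" "u \<ge> ln (2 * T)" by auto
    have "exp (ln (2 * T)) \<le> exp u" using u(3) by (subst exp_le_cancel_iff)
    hence uT: "exp u \<ge> 2 * T" using T1 by simp
    define w where "w = (\<lambda>n::nat. real n powr (-(1 + 1 / u)))"
    have w0: "w n \<ge> 0" for n by (simp add: w_def)
    have \<delta>: "0 < 1 / u" "1 / u \<le> 1" using u by auto
    show ?case
    proof (rule ccontr)
      assume "\<not> (\<exists>p::nat. prime p \<and> \<bar>ln (real p) - u\<bar> < \<epsilon>)"
      hence np: "\<bar>ln (real p) - u\<bar> \<ge> \<epsilon>" if "prime p" for p :: nat
        using that linorder_not_less by metis
      define M where "M = {n::nat. primepow n \<and> \<not> prime n \<and> \<bar>ln (real n) - u\<bar> < \<epsilon>}"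
      have Msub: "M \<subseteq> {n. primepow n \<and> \<not> prime n \<and> real n \<le> exp (u + \<epsilon>)}"
      proof safe
        fix n assume n: "n \<in> M"
        hence "n > 0" by (auto simp: M_def intro!: Nat.gr0I)
        hence "real n = exp (ln (real n))" by simp
        also have "\<dots> \<le> exp (u + \<epsilon>)" using n by (subst exp_le_cancel_iff) (auto simp: M_def)
        finally show "real n \<le> exp (u + \<epsilon>)" .
      qed (auto simp: M_def)
      have y1: "exp (u + \<epsilon>) \<ge> 1" using u \<epsilon> by simp
      have finM: "finite M" by (rule finite_subset[OF Msub card_proper_prime_powers_le(1)[OF y1]])
      have "sqrt (exp (u + \<epsilon>)) = exp ((u + \<epsilon>) / 2)"
        by (rule real_sqrt_unique) (simp_all add: power2_eq_square exp_add[symmetric])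
      hence cardM: "real (card M) \<le> 2 * exp ((u + \<epsilon>) / 2) * (2 * (u + \<epsilon>) + 1)"
        using card_mono[OF card_proper_prime_powers_le(1)[OF y1] Msub] card_proper_prime_powers_le(2)[OF y1]
        by simp
      have EM: "(\<Sum>n\<in>M. mangoldt n * w n) \<le> E u"
      proof -
        have "(\<Sum>n\<in>M. mangoldt n * w n) \<le> (\<Sum>n\<in>M. (u + \<epsilon>) * exp (- (u - \<epsilon>)))"
        proof (intro sum_mono mult_mono)
          fix n assume n: "n \<in> M"
          hence n0: "n > 0" by (auto simp: M_def intro!: Nat.gr0I)
          show "mangoldt n \<le> u + \<epsilon>" using mangoldt_le_ln[of n] n by (auto simp: M_def)
          have "w n \<le> real n powr (-1)" unfolding w_def using n0 \<delta> by (intro powr_mono) auto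
          also have "\<dots> = exp (- ln (real n))" using n0 by (simp add: powr_def)
          also have "\<dots> \<le> exp (- (u - \<epsilon>))" using n by (subst exp_le_cancel_iff) (auto simp: M_def)
          finally show "w n \<le> exp (- (u - \<epsilon>))" .
        qed (use u \<epsilon> w0 in auto)
        also have "\<dots> = real (card M) * ((u + \<epsilon>) * exp (- (u - \<epsilon>)))" by simp
        also have "\<dots> \<le> E u" unfolding E_def using cardM u \<epsilon> by (intro mult_right_mono) auto
        finally show ?thesis .
      qed
      define f1 where "f1 = (\<lambda>n. mangoldt n * (w n * ker 1 (ln (real n) - u)))"
      define fT where "fT = (\<lambda>n. mangoldt n * (w n * ker T (ln (real n) - u)))"
      define g where "g = (\<lambda>n. if n \<in> M then mangoldt n * w n else 0)"
      have sumf: "summable f1" "summable fT" unfolding f1_def fT_def w_def using ksum_summable(1)[OF \<delta>(1)] T1 by auto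
      have g: "g sums (\<Sum>n\<in>M. mangoldt n * w n)" unfolding g_def by (rule sums_If_finite_set[OF finM])
      \<comment> \<open>Outside the window the first summand dominates, by the decay of the kernel.
        Inside it a prime power is not prime, hence in \<open>M\<close>, and the second summand
        dominates through the trivial bound on the kernel.\<close>
      have pw: "fT n \<le> 80 * T * (1 + 1 / \<epsilon>\<^sup>2) * f1 n + T ^ 3 / 3 * g n" for n
      proof (cases "mangoldt n = (0::real)")
        case True
        thus ?thesis by (simp add: fT_def f1_def g_def)
      next
        case False
        hence pp: "primepow n" by (auto simp: mangoldt_def split: if_splits)
        let ?v = "ln (real n) - u"
        have mw: "mangoldt n * w n \<ge> 0" using w0 by (simp add: mangoldt_nonneg)
        have f1n: "80 * T * (1 + 1 / \<epsilon>\<^sup>2) * f1 n \<ge> 0"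
          using mw T1 ker_nonneg[of 1] unfolding f1_def
          by (intro mult_nonneg_nonneg add_nonneg_nonneg) (auto simp: mangoldt_nonneg w0)
        show ?thesis
        proof (cases "\<bar>?v\<bar> < \<epsilon>")
          case True
          hence "n \<in> M" using pp np[of n] by (auto simp: M_def)
          hence "T ^ 3 / 3 * g n = mangoldt n * w n * (T ^ 3 / 3)" by (simp add: g_def)
          moreover have "fT n \<le> mangoldt n * w n * (T ^ 3 / 3)"
            unfolding fT_def mult.assoc[symmetric] using T1 by (intro mult_left_mono ker_le_cube mw) auto
          ultimately show ?thesis using f1n by linarith
        next
          case False
          hence v: "\<bar>?v\<bar> \<ge> \<epsilon>" "?v \<noteq> 0" using \<epsilon> by auto
          have v2: "?v\<^sup>2 \<ge> \<epsilon>\<^sup>2" using v(1) \<epsilon> by (metis abs_le_square_iff abs_of_pos)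
          \<comment> \<open>For \<open>|v| >= \<epsilon>\<close> the quantities \<open>v^2\<close>
            and \<open>1 + v^2\<close> are comparable, which makes room for
            \<open>ker_1_ge\<close>.\<close>
          have "1 / ?v\<^sup>2 \<le> (1 + 1 / \<epsilon>\<^sup>2) / (1 + ?v\<^sup>2)"
          proof -
            have "1 + ?v\<^sup>2 \<le> (1 + 1 / \<epsilon>\<^sup>2) * ?v\<^sup>2" using v2 \<epsilon> by (simp add: field_simps)
            thus ?thesis using v(2) by (simp add: divide_simps add_pos_nonneg mult.commute)
          qed
          hence "4 * T * (1 / ?v\<^sup>2) \<le> 4 * T * ((1 + 1 / \<epsilon>\<^sup>2) / (1 + ?v\<^sup>2))" using T1 by (intro mult_left_mono) auto
          also have "\<dots> = 80 * T * (1 + 1 / \<epsilon>\<^sup>2) * (1 / (20 * (1 + ?v\<^sup>2)))"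
          proof -
            have "4 * T * (a / b) = 80 * T * a * (1 / (20 * b))" for a b :: real by simp
            thus ?thesis by blast
          qed
          also have "\<dots> \<le> 80 * T * (1 + 1 / \<epsilon>\<^sup>2) * ker 1 ?v"
            using T1 by (intro mult_left_mono ker_1_ge mult_nonneg_nonneg) auto
          finally have "ker T ?v \<le> 80 * T * (1 + 1 / \<epsilon>\<^sup>2) * ker 1 ?v"
            using ker_le_inverse_square[of T ?v] v(2) T1 by simp
          from mult_left_mono[OF this mw] have "fT n \<le> 80 * T * (1 + 1 / \<epsilon>\<^sup>2) * f1 n"
            by (simp add: fT_def f1_def mult_ac)
          moreover have "T ^ 3 / 3 * g n \<ge> 0" using T1 mw by (simp add: g_def)
          ultimately show ?thesis by linarith
        qed
      qed
      have "(\<Sum>n. fT n) \<le> 80 * T * (1 + 1 / \<epsilon>\<^sup>2) * (\<Sum>n. f1 n) + T ^ 3 / 3 * (\<Sum>n\<in>M. mangoldt n * w n)"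
        by (rule sums_le[OF pw summable_sums[OF sumf(2)] sums_add[OF sums_mult[OF summable_sums[OF sumf(1)]] sums_mult[OF g]]])
      also have "\<dots> \<le> 80 * T * (1 + 1 / \<epsilon>\<^sup>2) * (8 + 24 * pi + \<bar>C0\<bar>) + T ^ 3 / 3 * E u"
      proof (intro add_mono mult_left_mono EM)
        have "(\<Sum>n. f1 n) \<le> (8 + 24 * pi) + C0 / u"
          using C0[of u "1 / u"] u \<delta> ksum_one_le[OF \<delta>(1), of u] by (simp add: f1_def w_def)
        moreover have "C0 / u \<le> \<bar>C0\<bar> / u" using u by (intro divide_right_mono) auto
        moreover have "\<bar>C0\<bar> / u \<le> \<bar>C0\<bar> / 1" using u by (intro divide_left_mono) auto
        ultimately show "(\<Sum>n. f1 n) \<le> 8 + 24 * pi + \<bar>C0\<bar>" by simp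
      qed (use T1 in \<open>auto intro!: mult_nonneg_nonneg add_nonneg_nonneg\<close>)
      also have "80 * T * (1 + 1 / \<epsilon>\<^sup>2) * (8 + 24 * pi + \<bar>C0\<bar>) = D * T" by (simp add: D_def)
      finally have "(\<Sum>n. fT n) \<le> D * T + T ^ 3 / 3 * E u" .
      moreover have "(\<Sum>n. w n * ker T (ln (real n) - u)) \<le> (\<Sum>n. fT n) + CT / u"
        using CT[of u "1 / u"] u \<delta> by (simp add: fT_def w_def)
      moreover have "c * T\<^sup>2 \<le> (\<Sum>n. w n * ker T (ln (real n) - u))"
        using ksum_ge[OF T1 u(1) uT] by (simp add: c_def w_def)
      ultimately show False using T elim(1) by linarith
    qed
  qed
qed

lemma prime_in_short_interval:
  assumes "\<eta> > (0::real)"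
  shows "\<forall>\<^sub>F x in at_top. \<exists>p::nat. prime p \<and> x < real p \<and> real p < (1 + \<eta>) * x"
proof -
  \<comment> \<open>With this half-width, the logarithmic window centred at
    \<open>ln x + \<epsilon>\<close> is exactly the interval from \<open>x\<close> to
    \<open>(1 + \<eta>) * x\<close>.\<close>
  define \<epsilon> where "\<epsilon> = ln (1 + \<eta>) / 2"
  have \<epsilon>: "\<epsilon> > 0" using assms by (simp add: \<epsilon>_def)
  have "filterlim (\<lambda>x. ln x + \<epsilon>) at_top at_top" by real_asymp
  from eventually_compose_filterlim[OF prime_in_log_window[OF \<epsilon>] this] eventually_gt_at_top[of 0]
  show ?thesis
  proof eventually_elim
    case (elim x)
    then obtain p :: nat where p: "prime p" "\<bar>ln (real p) - (ln x + \<epsilon>)\<bar> < \<epsilon>" by auto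
    have p0: "real p > 0" using prime_gt_0_nat[OF p(1)] by simp
    have "ln x < ln (real p)" "ln (real p) < ln x + 2 * \<epsilon>" using p(2) by linarith+
    moreover have "ln x + 2 * \<epsilon> = ln ((1 + \<eta>) * x)" using elim assms by (simp add: \<epsilon>_def ln_mult)
    ultimately have "x < real p" "real p < (1 + \<eta>) * x" using p0 elim assms by simp_all
    thus ?case using p(1) by blast
  qed
qed

section \<open>Sidon sets and magic labellings\<close>

text \<open>Ruzsa's construction: \<open>\<phi> k\<close> is congruent to \<open>k\<close> modulo
  \<open>p - 1\<close> and to \<open>g^k\<close> modulo \<open>p\<close>. Equal sums thus give equal
  products of the powers of \<open>g\<close> by the first congruence and equal sums of them by the
  second, so both pairs consist of the roots of one quadratic modulo \<open>p\<close>.\<close>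

lemma ruzsa_sidon:
  fixes p :: nat
  assumes p: "prime p"
  obtains \<phi> :: "nat \<Rightarrow> int" where
    "\<And>a b c d. \<lbrakk>a < p - 1; b < p - 1; c < p - 1; d < p - 1; [\<phi> a + \<phi> b = \<phi> c + \<phi> d] (mod int (p * (p - 1)))\<rbrakk>
       \<Longrightarrow> {a, b} = {c, d}"
proof -
  obtain g where g: "residue_primroot p g" using prime_primitive_root_exists[of p] p prime_gt_1_nat[OF p] by auto
  have cop: "coprime p g" and ord: "ord p g = p - 1"
    using g p by (auto simp: residue_primroot_def totient_prime)
  define G where "G = (\<lambda>k. int (g ^ k))"
  have G_cong: "[G d = G e] (mod int p) \<longleftrightarrow> [d = e] (mod (p - 1))" for d e
    unfolding G_def cong_int_iff using order_divides_expdiff[OF cop, of d e] ord by simp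
  have G_eq: "d = e" if "[G d = G e] (mod int p)" "d < p - 1" "e < p - 1" for d e
    using that G_cong cong_less_modulus_unique_nat by blast
  define \<phi> where "\<phi> = (\<lambda>k. int p * int k - (int p - 1) * G k)"
  have p1: "int (p - 1) = int p - 1" using prime_gt_0_nat[OF p] by simp
  have phi1: "[\<phi> k = int k] (mod int (p - 1))" for k
    unfolding cong_iff_dvd_diff p1 \<phi>_def by (rule dvdI[of _ _ "int k - G k"]) (simp add: algebra_simps)
  have phi2: "[\<phi> k = G k] (mod int p)" for k
    unfolding cong_iff_dvd_diff \<phi>_def by (rule dvdI[of _ _ "int k - G k"]) (simp add: algebra_simps)
  show ?thesis
  proof (rule that)
    fix a b c d assume lt: "a < p - 1" "b < p - 1" "c < p - 1" "d < p - 1"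
      and *: "[\<phi> a + \<phi> b = \<phi> c + \<phi> d] (mod int (p * (p - 1)))"
    have m1: "[\<phi> a + \<phi> b = \<phi> c + \<phi> d] (mod int (p - 1))" and m2: "[\<phi> a + \<phi> b = \<phi> c + \<phi> d] (mod int p)"
      by (rule cong_dvd_modulus[OF *], simp)+
    have "[int a + int b = int c + int d] (mod int (p - 1))"
      using cong_trans[OF cong_sym[OF cong_add[OF phi1 phi1]] cong_trans[OF m1 cong_add[OF phi1 phi1]]] .
    hence "[a + b = c + d] (mod (p - 1))" by (simp flip: cong_int_iff)
    hence "[G (a + b) = G (c + d)] (mod int p)" by (simp add: G_cong)
    hence prod: "int p dvd G a * G b - G c * G d" by (simp add: cong_iff_dvd_diff G_def power_add)
    have s: "[G a + G b = G c + G d] (mod int p)"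
      using cong_trans[OF cong_sym[OF cong_add[OF phi2 phi2]] cong_trans[OF m2 cong_add[OF phi2 phi2]]] .
    hence sum: "int p dvd (G a + G b) - (G c + G d)" by (simp add: cong_iff_dvd_diff)
    \<comment> \<open>The monic quadratic with roots \<open>G c\<close> and \<open>G d\<close>,
      evaluated at \<open>G a\<close>; modulo \<open>p\<close> it vanishes because the sums and the
      products agree.\<close>
    have "(G a - G c) * (G a - G d) = G a * ((G a + G b) - (G c + G d)) - (G a * G b - G c * G d)"
      by (simp add: algebra_simps)
    also have "int p dvd \<dots>" by (rule dvd_diff[OF dvd_mult[OF sum] prod])
    finally have "int p dvd G a - G c \<or> int p dvd G a - G d"
      using p by (simp add: prime_dvd_mult_iff)
    thus "{a, b} = {c, d}"
    proof
      assume "int p dvd G a - G c"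
      hence "a = c" using lt G_eq by (simp add: cong_iff_dvd_diff)
      moreover from this s have "b = d" using lt G_eq by (simp add: cong_add_lcancel)
      ultimately show ?thesis by simp
    next
      assume "int p dvd G a - G d"
      hence "a = d" using lt G_eq by (simp add: cong_iff_dvd_diff)
      moreover from this s have "b = c" using lt G_eq by (simp add: cong_add_lcancel add.commute[of "G c"])
      ultimately show ?thesis by auto
    qed
  qed
qed

lemma sparse_residue_class:
  fixes val :: "'a \<Rightarrow> int"
  assumes "finite S" "M > 0"
  obtains T where "0 \<le> T" "T < int M" "M * card {x \<in> S. val x mod int M = T} \<le> card S"
proof -
  have "\<exists>T\<in>{0..<int M}. M * card {x \<in> S. val x mod int M = T} \<le> card S"
  proof (rule ccontr)
    assume "\<not> ?thesis"
    hence *: "card S < M * card {x \<in> S. val x mod int M = T}" if "T \<in> {0..<int M}" for T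
      using that by (meson linorder_not_less)
    have "M * card S = (\<Sum>T\<in>{0..<int M}. card S)" by simp
    also have "\<dots> < (\<Sum>T\<in>{0..<int M}. M * card {x \<in> S. val x mod int M = T})"
      using * assms by (intro sum_strict_mono) auto
    also have "\<dots> = M * (\<Sum>T\<in>{0..<int M}. \<Sum>x | x \<in> S \<and> val x mod int M = T. 1)"
      by (simp add: sum_distrib_left)
    also have "(\<Sum>T\<in>{0..<int M}. \<Sum>x | x \<in> S \<and> val x mod int M = T. 1) = (\<Sum>x\<in>S. 1::nat)"
      by (rule sum.group) (use assms in auto)
    finally show False by simp
  qed
  thus ?thesis using that by auto
qed

section \<open>From Sidon sets to magic sums\<close>

text \<open>The vertex labels determine the edge labels as \<open>s - v a - v b\<close>. The Sidon
  property separates edge labels from one another, and \<open>triple\<close> separates them from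
  vertex labels; there \<open>c\<close> may equal \<open>a\<close> or \<open>b\<close>, since an
  edge label must also differ from those of its own ends.\<close>

lemma I_K_le:
  assumes J: "finite J" "card J = n"
    and inj: "inj_on v J" and pos: "\<And>a. a \<in> J \<Longrightarrow> v a > (0::nat)"
    and lt: "\<And>a b. \<lbrakk>a \<in> J; b \<in> J; a \<noteq> b\<rbrakk> \<Longrightarrow> v a + v b < s"
    and sidon: "\<And>a b c d. \<lbrakk>a \<in> J; b \<in> J; c \<in> J; d \<in> J; v a + v b = v c + v d\<rbrakk> \<Longrightarrow> {a, b} = {c, d}"
    and triple: "\<And>a b c. \<lbrakk>a \<in> J; b \<in> J; c \<in> J; a \<noteq> b\<rbrakk> \<Longrightarrow> v a + v b + v c \<noteq> s"
  shows "I_K n \<le> s"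
proof -
  obtain h where h: "bij_betw h {..<n} J"
    using J finite_same_card_bij[of "{..<n}" J] by auto
  have hJ: "h i \<in> J" if "i < n" for i using h that by (auto simp: bij_betw_def)
  have hi: "i = j" if "h i = h j" "i < n" "j < n" for i j
    using h that by (auto simp: bij_betw_def inj_on_def)
  \<comment> \<open>The subtraction is truncated, but \<open>lt'\<close> shows that on edges it is a
    true and positive difference.\<close>
  define l where "l = case_sum (\<lambda>i. v (h i)) (\<lambda>e. s - (\<Sum>i\<in>e. v (h i)))"
  have lL: "l (Inl i) = v (h i)" for i by (simp add: l_def)
  have lR: "l (Inr {i, j}) = s - (v (h i) + v (h j))" if "i \<noteq> j" for i j using that by (simp add: l_def)
  have lt': "v (h i) + v (h j) < s" if "i < n" "j < n" "i \<noteq> j" for i j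
    using lt[of "h i" "h j"] hJ hi that by blast
  have "edge_magic_injection (complete_vertices n) (complete_edges n) l s"
    unfolding edge_magic_injection_def
  proof (intro conjI ballI allI impI)
    show "inj_on l (Inl ` complete_vertices n \<union> Inr ` complete_edges n)"
    proof (rule inj_onI)
      fix x y assume x: "x \<in> Inl ` complete_vertices n \<union> Inr ` complete_edges n"
        and y: "y \<in> Inl ` complete_vertices n \<union> Inr ` complete_edges n" and eq: "l x = l y"
      have VE: "l (Inl k) \<noteq> l (Inr {i, j})" if "k < n" "i < n" "j < n" "i \<noteq> j" for i j k
        using triple[of "h i" "h j" "h k"] hJ hi lt'[of i j] that by (force simp: lL lR)
      have VV: "i = j" if "l (Inl i) = l (Inl j)" "i < n" "j < n" for i j
        using inj hJ hi that by (auto simp: lL inj_on_def)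
      have EE: "{i, j} = {i', j'}" if "l (Inr {i, j}) = l (Inr {i', j'})"
        "i < n" "j < n" "i' < n" "j' < n" "i \<noteq> j" "i' \<noteq> j'" for i j i' j'
      proof -
        have "v (h i) + v (h j) = v (h i') + v (h j')"
          using that lt'[of i j] lt'[of i' j'] by (simp add: lR)
        hence "{h i, h j} = {h i', h j'}" using sidon hJ that by blast
        hence "h ` {i, j} = h ` {i', j'}" by simp
        thus ?thesis using h that by (subst (asm) inj_on_image_eq_iff[of h "{..<n}"]) (auto simp: bij_betw_def)
      qed
      have cases: "(\<exists>i<n. z = Inl i) \<or> (\<exists>i j. i < n \<and> j < n \<and> i \<noteq> j \<and> z = Inr {i, j})"
        if "z \<in> Inl ` complete_vertices n \<union> Inr ` complete_edges n" for z
        using that by (auto simp: complete_vertices_def complete_edges_def)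
      from cases[OF x] cases[OF y] show "x = y"
      proof (elim disjE exE conjE)
        fix i j assume "i < n" "x = Inl i" "j < n" "y = Inl j"
        thus ?thesis using VV eq by simp
      next
        fix i j k assume "k < n" "x = Inl k" "i < n" "j < n" "i \<noteq> j" "y = Inr {i, j}"
        thus ?thesis using VE eq by simp
      next
        fix i j k assume "i < n" "j < n" "i \<noteq> j" "x = Inr {i, j}" "k < n" "y = Inl k"
        thus ?thesis using VE[of k i j] eq by simp
      next
        fix i j i' j' assume "i < n" "j < n" "i \<noteq> j" "x = Inr {i, j}" "i' < n" "j' < n" "i' \<noteq> j'" "y = Inr {i', j'}"
        thus ?thesis using EE[of i j i' j'] eq by simp
      qed
    qed
  next
    fix x assume "x \<in> Inl ` complete_vertices n \<union> Inr ` complete_edges n"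
    thus "l x > 0"
      using pos hJ lt' by (auto simp: complete_vertices_def complete_edges_def lL lR)
  next
    fix a b assume "a \<noteq> b \<and> {a, b} \<in> complete_edges n"
    hence "a \<noteq> b" "a < n" "b < n" by (auto simp: complete_edges_def doubleton_eq_iff)
    thus "l (Inl a) + l (Inl b) + l (Inr {a, b}) = s" using lt'[of a b] by (simp add: lL lR)
  qed
  thus ?thesis unfolding I_K_def by (intro Least_le) blast
qed

text \<open>The forbidden representations of \<open>s\<close> have three distinct indices or one
  doubled index. Deleting one index from each of them leaves at least \<open>n\<close> indices that
  satisfy \<open>triple\<close>.\<close>

lemma I_K_le_by_deletion:
  fixes w :: "nat \<Rightarrow> nat"
  assumes w: "\<And>k. k < m \<Longrightarrow> 0 < w k \<and> w k \<le> M" and s: "2 * M \<le> s"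
    and sidon: "\<And>a b c d. \<lbrakk>a < m; b < m; c < m; d < m; w a + w b = w c + w d\<rbrakk> \<Longrightarrow> {a, b} = {c, d}"
    and few: "card {X. X \<subseteq> {..<m} \<and> card X = 3 \<and> sum w X = s} +
      card {(a, b). a < m \<and> b < m \<and> a \<noteq> b \<and> 2 * w a + w b = s} + n \<le> m"
  shows "I_K n \<le> s"
proof -
  let ?B1 = "{X. X \<subseteq> {..<m} \<and> card X = 3 \<and> sum w X = s}"
  let ?B2 = "{(a, b). a < m \<and> b < m \<and> a \<noteq> b \<and> 2 * w a + w b = s}"
  have fin: "finite ?B1" "finite ?B2"
    by (rule finite_subset[of _ "Pow {..<m}"], auto) (rule finite_subset[of _ "{..<m} \<times> {..<m}"], auto)
  \<comment> \<open>One index per forbidden representation: the least of a triple, the doubled one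
    of a pair.\<close>
  define H where "H = Min ` ?B1 \<union> fst ` ?B2"
  have "card H \<le> card ?B1 + card ?B2"
    unfolding H_def by (rule order_trans[OF card_Un_le add_mono[OF card_image_le card_image_le]]) (use fin in auto)
  moreover have "finite H" using fin by (simp add: H_def)
  ultimately have "card ({..<m} - H) \<ge> n"
    using diff_card_le_card_Diff[of H "{..<m}"] few by simp
  then obtain J where J: "J \<subseteq> {..<m} - H" "card J = n" "finite J"
    by (rule obtain_subset_with_card_n)
  have Jm: "a < m" if "a \<in> J" for a using J(1) that by auto
  have inj: "a = b" if "w a = w b" "a < m" "b < m" for a b
    using sidon[of a a b a] that by auto
  show ?thesis
  proof (rule I_K_le[OF J(3,2)])
    show "inj_on w J" using inj Jm by (auto simp: inj_on_def)
    show "w a > 0" if "a \<in> J" for a using w Jm that by auto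
    show "w a + w b < s" if "a \<in> J" "b \<in> J" "a \<noteq> b" for a b
    proof -
      \<comment> \<open>Distinct labels bounded by \<open>M\<close> sum to strictly less than
        \<open>2 * M\<close>, so \<open>s = 2 * M\<close> is already admissible here.\<close>
      have "w a \<noteq> w b" using inj[of a b] Jm that by blast
      moreover have "w a \<le> M" "w b \<le> M" using w Jm that by auto
      ultimately show ?thesis using s by linarith
    qed
    show "{a, b} = {c, d}" if "a \<in> J" "b \<in> J" "c \<in> J" "d \<in> J" "w a + w b = w c + w d" for a b c d
      using sidon that Jm by blast
    have pair: "2 * w a + w b \<noteq> s" if "a \<in> J" "b \<in> J" "a \<noteq> b" for a b
    proof
      assume "2 * w a + w b = s"
      hence "(a, b) \<in> ?B2" using that Jm by auto
      hence "a \<in> H" unfolding H_def by force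
      thus False using J(1) that by auto
    qed
    show "w a + w b + w c \<noteq> s" if "a \<in> J" "b \<in> J" "c \<in> J" "a \<noteq> b" for a b c
    proof
      assume eq: "w a + w b + w c = s"
      have "c \<noteq> a" "c \<noteq> b" using eq pair[of a b] pair[of b a] that by auto
      hence "{a, b, c} \<in> ?B1" using that eq Jm by (auto simp: add.assoc)
      hence "Min {a, b, c} \<in> H" unfolding H_def by blast
      moreover have "Min {a, b, c} \<in> {a, b, c}" by (rule Min_in) auto
      ultimately show False using J(1) that by auto
    qed
  qed
qed

text \<open>The hypothesis \<open>few\<close> says that a residue class modulo \<open>M\<close> has
  on average at most \<open>2 * (m - n)\<close> forbidden representations. A class no worse than
  average is translated to a residue \<open>j < 3\<close>. Its representations of
  \<open>M + j\<close> and of \<open>2 * M + j\<close> are disjoint, so one value has at most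
  \<open>m - n\<close> of them, which can be deleted.\<close>

lemma I_K_le_of_sidon:
  fixes \<phi> :: "nat \<Rightarrow> int"
  assumes M: "M > 0" and n: "n \<le> m"
    and sidon: "\<And>a b c d. \<lbrakk>a < m; b < m; c < m; d < m; [\<phi> a + \<phi> b = \<phi> c + \<phi> d] (mod int M)\<rbrakk> \<Longrightarrow> {a, b} = {c, d}"
    and few: "(m choose 3) + m * (m - 1) \<le> M * (2 * (m - n))"
  shows "I_K n \<le> 2 * M + 3"
proof -
  let ?A = "{X. X \<subseteq> {..<m} \<and> card X = 3}" and ?B = "{(a, b). a < m \<and> b < m \<and> a \<noteq> b}"
  define S where "S = ?A <+> ?B"
  define val :: "(nat \<Rightarrow> int) \<Rightarrow> nat set + nat \<times> nat \<Rightarrow> int" where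
    "val = (\<lambda>w. case_sum (\<lambda>X. \<Sum>k\<in>X. w k) (\<lambda>(a, b). 2 * w a + w b))"
  have fin: "finite ?A" "finite ?B"
    by (rule finite_subset[of _ "Pow {..<m}"], auto) (rule finite_subset[of _ "{..<m} \<times> {..<m}"], auto)
  have "?B = (SIGMA a:{..<m}. {..<m} - {a})" by auto
  hence "card ?B = m * (m - 1)" by simp
  hence cardS: "card S = (m choose 3) + m * (m - 1)"
    unfolding S_def using fin n_subsets[of "{..<m}" 3] by (simp add: card_Plus)
  have finS: "finite S" using fin by (simp add: S_def)
  obtain T where T: "0 \<le> T" "T < int M" "M * card {x \<in> S. val \<phi> x mod int M = T} \<le> card S"
    using sparse_residue_class[OF finS M] by blast
  \<comment> \<open>Translating the labels by \<open>r\<close> moves a sum of three labels by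
    \<open>3 * r\<close>; so \<open>T\<close> can be reduced only to its remainder modulo 3.\<close>
  define j where "j = nat (T mod 3)"
  define r where "r = T div 3"
  have Tj: "T = 3 * r + int j" and j: "j < 3" by (auto simp: r_def j_def)
  \<comment> \<open>Representatives are taken from 1 to \<open>M\<close> rather than from 0, because
    labels must be positive.\<close>
  define \<rho> where "\<rho> = (\<lambda>k. (\<phi> k - r - 1) mod int M + 1)"
  have \<rho>: "1 \<le> \<rho> k" "\<rho> k \<le> int M" for k
    using M pos_mod_bound[of "int M" "\<phi> k - r - 1"] by (simp_all add: \<rho>_def zless_imp_add1_zle)
  have \<rho>_cong: "[\<rho> k = \<phi> k - r] (mod int M)" for k
    unfolding \<rho>_def cong_def by (metis diff_add_cancel mod_add_left_eq)
  have sidon': "{a, b} = {c, d}" if "a < m" "b < m" "c < m" "d < m" "\<rho> a + \<rho> b = \<rho> c + \<rho> d" for a b c d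
  proof (rule sidon)
    have "[(\<phi> a - r) + (\<phi> b - r) = \<rho> a + \<rho> b] (mod int M)"
      by (intro cong_add cong_sym[OF \<rho>_cong])
    also have "\<rho> a + \<rho> b = \<rho> c + \<rho> d" by fact
    also have "[\<dots> = (\<phi> c - r) + (\<phi> d - r)] (mod int M)" by (intro cong_add \<rho>_cong)
    finally show "[\<phi> a + \<phi> b = \<phi> c + \<phi> d] (mod int M)" by (simp add: cong_iff_dvd_diff algebra_simps)
  qed fact+
  define Bad where "Bad = (\<lambda>w s. {x \<in> S. val w x = s})"
  have finBad: "finite (Bad w s)" for w s using finS by (simp add: Bad_def)
  have sub: "Bad \<rho> (i * int M + int j) \<subseteq> {x \<in> S. val \<phi> x mod int M = T}" for i
  proof
    fix x assume x: "x \<in> Bad \<rho> (i * int M + int j)"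
    have "[val \<rho> x = val \<phi> x - 3 * r] (mod int M)"
    proof (cases x)
      case (Inl X)
      have "[(\<Sum>k\<in>X. \<rho> k) = (\<Sum>k\<in>X. \<phi> k - r)] (mod int M)" by (intro cong_sum \<rho>_cong)
      thus ?thesis using x Inl by (auto simp: Bad_def S_def val_def sum_subtractf)
    next
      case (Inr y)
      then obtain a b where y: "x = Inr (a, b)" by (cases y) auto
      have "[2 * \<rho> a + \<rho> b = 2 * (\<phi> a - r) + (\<phi> b - r)] (mod int M)"
        by (intro cong_add cong_mult \<rho>_cong cong_refl)
      thus ?thesis using y by (simp add: val_def algebra_simps)
    qed
    hence "[val \<phi> x - 3 * r = i * int M + int j] (mod int M)" using x by (simp add: Bad_def cong_sym)
    from cong_add[OF this cong_refl[of "3 * r"]]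
    have "[val \<phi> x = T + i * int M] (mod int M)" by (simp add: Tj add_ac)
    hence "[val \<phi> x = T] (mod int M)" by (simp add: cong_def)
    thus "x \<in> {x \<in> S. val \<phi> x mod int M = T}" using x T by (simp add: Bad_def cong_def)
  qed
  \<comment> \<open>The two bad sets are disjoint parts of the sparse class, so the smaller has at
    most half its size. The factor 1 keeps the form \<open>i * int M + int j\<close> of
    \<open>sub\<close>.\<close>
  have "card (Bad \<rho> (1 * int M + int j)) + card (Bad \<rho> (2 * int M + int j)) =
      card (Bad \<rho> (1 * int M + int j) \<union> Bad \<rho> (2 * int M + int j))"
    using M by (intro card_Un_disjoint[symmetric] finBad) (auto simp: Bad_def)
  also have "\<dots> \<le> card {x \<in> S. val \<phi> x mod int M = T}"
    using sub by (intro card_mono) (use finS in \<open>auto simp del: mult_1\<close>)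
  also have "\<dots> \<le> 2 * (m - n)"
  proof -
    have "M * card {x \<in> S. val \<phi> x mod int M = T} \<le> M * (2 * (m - n))" using T(3) cardS few by linarith
    thus ?thesis using M by simp
  qed
  finally have "card (Bad \<rho> (2 * int M + int j)) \<le> m - n \<or> card (Bad \<rho> (int M + int j)) \<le> m - n" by simp linarith
  \<comment> \<open>Stated for an arbitrary labelling because it is applied to \<open>\<rho>\<close>
    and to its reflection.\<close>
  have bound: "I_K n \<le> s" if w: "\<And>k. k < m \<Longrightarrow> 1 \<le> w k \<and> w k \<le> int M" and s: "2 * M \<le> s"
    and sid: "\<And>a b c d. \<lbrakk>a < m; b < m; c < m; d < m; w a + w b = w c + w d\<rbrakk> \<Longrightarrow> {a, b} = {c, d}"
    and few: "card (Bad w (int s)) \<le> m - n" for w s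
  proof (rule I_K_le_by_deletion[where w = "\<lambda>k. nat (w k)" and M = M and m = m])
    have eqi: "int (nat (w k)) = w k" if "k < m" for k using w[OF that] by simp
    show "0 < nat (w k) \<and> nat (w k) \<le> M" if "k < m" for k using w[OF that] by auto
    show "{a, b} = {c, d}" if "a < m" "b < m" "c < m" "d < m" "nat (w a) + nat (w b) = nat (w c) + nat (w d)" for a b c d
    proof (rule sid)
      show "w a + w b = w c + w d"
        using that(5) eqi[OF that(1)] eqi[OF that(2)] eqi[OF that(3)] eqi[OF that(4)] by linarith
    qed fact+
    have "Bad w (int s) = {X. X \<subseteq> {..<m} \<and> card X = 3 \<and> (\<Sum>k\<in>X. nat (w k)) = s} <+>
       {(a, b). a < m \<and> b < m \<and> a \<noteq> b \<and> 2 * nat (w a) + nat (w b) = s}" (is "_ = ?P <+> ?Q")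
    proof -
      have 1: "(\<Sum>k\<in>X. w k) = int s \<longleftrightarrow> (\<Sum>k\<in>X. nat (w k)) = s" if "X \<subseteq> {..<m}" for X
      proof -
        have "int (\<Sum>k\<in>X. nat (w k)) = (\<Sum>k\<in>X. w k)"
          unfolding of_nat_sum by (intro sum.cong refl eqi) (use that in auto)
        thus ?thesis by (metis of_nat_eq_iff)
      qed
      have 2: "2 * w a + w b = int s \<longleftrightarrow> 2 * nat (w a) + nat (w b) = s" if "a < m" "b < m" for a b
        using eqi[OF that(1)] eqi[OF that(2)] by linarith
      show ?thesis using 1 2 by (auto simp: Bad_def S_def val_def)
    qed
    moreover have "finite ?P" "finite ?Q"
      by (rule finite_subset[OF _ fin(1)], auto) (rule finite_subset[OF _ fin(2)], auto)
    ultimately have "card (Bad w (int s)) = card ?P + card ?Q" by (simp add: card_Plus)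
    thus "card ?P + card ?Q + n \<le> m" using few n by linarith
  qed fact
  show ?thesis
    using \<open>card (Bad \<rho> (2 * int M + int j)) \<le> m - n \<or> card (Bad \<rho> (int M + int j)) \<le> m - n\<close>
  proof
    assume "card (Bad \<rho> (2 * int M + int j)) \<le> m - n"
    hence "card (Bad \<rho> (int (2 * M + j))) \<le> m - n" by simp
    with \<rho> have "I_K n \<le> 2 * M + j" by (intro bound[OF _ _ sidon']) simp_all
    thus ?thesis using j by linarith
  next
    assume *: "card (Bad \<rho> (int M + int j)) \<le> m - n"
    \<comment> \<open>The reflection preserves the range from 1 to \<open>M\<close> and the Sidon
      property, and it carries the sum \<open>M + j\<close> to
      \<open>3 * (M + 1) - (M + j) = 2 * M + 3 - j\<close>.\<close>
    define \<rho>' where "\<rho>' = (\<lambda>k. int M + 1 - \<rho> k)"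
    have "val \<rho>' x = 3 * (int M + 1) - val \<rho> x" if "x \<in> S" for x
      using that by (auto simp: S_def val_def \<rho>'_def sum_subtractf algebra_simps split: sum.splits)
    hence "Bad \<rho>' (int (2 * M + 3 - j)) = Bad \<rho> (int M + int j)"
      using j by (auto simp: Bad_def)
    hence "card (Bad \<rho>' (int (2 * M + 3 - j))) \<le> m - n" using * by simp
    moreover have "{a, b} = {c, d}" if "a < m" "b < m" "c < m" "d < m" "\<rho>' a + \<rho>' b = \<rho>' c + \<rho>' d" for a b c d
      by (rule sidon') (use that in \<open>simp_all add: \<rho>'_def\<close>)
    moreover have "1 \<le> \<rho>' k \<and> \<rho>' k \<le> int M" for k using \<rho>[of k] by (simp add: \<rho>'_def)
    moreover have "2 * M \<le> 2 * M + 3 - j" using j by simp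
    ultimately have "I_K n \<le> 2 * M + 3 - j" by (intro bound[of \<rho>'])
    thus ?thesis by linarith
  qed
qed

lemma choose_three_le: "6 * (m choose 3) \<le> m * (m - 1) * (m - 2)"
proof (cases "m \<ge> 2")
  case True
  then obtain k where k: "m = Suc (Suc k)" using le_Suc_ex by force
  have "3 * (Suc (Suc k) choose 3) = Suc (Suc k) * (Suc k choose 2)"
    using Suc_times_binomial_eq[of "Suc k" 2] by (simp add: numeral_3_eq_3 numeral_2_eq_2 mult.commute)
  moreover have "2 * (Suc k choose 2) = Suc k * k"
    using Suc_times_binomial_eq[of k 1] by (simp add: numeral_2_eq_2 mult.commute)
  ultimately have eq: "2 * (3 * (Suc (Suc k) choose 3)) = Suc (Suc k) * (Suc k * k)"
    by (simp only: mult.left_commute[of 2])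
  have "m * (m - 1) * (m - 2) = Suc (Suc k) * (Suc k * k)" unfolding k by (simp add: algebra_simps)
  moreover have "6 * (m choose 3) = 2 * (3 * (Suc (Suc k) choose 3))" unfolding k by simp
  ultimately show ?thesis using eq by linarith
qed (simp add: binomial_eq_0)

section \<open>Choice of parameters and the asymptotic bound\<close>

text \<open>Ruzsa's set has \<open>m = p - 1\<close> elements modulo \<open>M = p * (p - 1)\<close>,
  with about \<open>p / 6\<close> forbidden representations per class. Half of them must be deleted,
  which leaves about \<open>11 p / 12\<close> labels; the 2 in the hypothesis absorbs the
  lower-order terms.\<close>

lemma I_K_le_prime:
  assumes p: "prime p" and n: "12 * (n + 2) \<le> 11 * p"
  shows "I_K n \<le> 2 * p\<^sup>2"
proof -
  obtain q where q: "p = q + 2" using prime_ge_2_nat[OF p] le_Suc_ex by (metis add.commute)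
  obtain \<phi> where \<phi>: "\<And>a b c d. \<lbrakk>a < p - 1; b < p - 1; c < p - 1; d < p - 1; [\<phi> a + \<phi> b = \<phi> c + \<phi> d] (mod int (p * (p - 1)))\<rbrakk>
       \<Longrightarrow> {a, b} = {c, d}" using ruzsa_sidon[OF p] by metis
  have n12: "12 * n + 24 \<le> 11 * p" using n by (simp add: distrib_left)
  hence n': "n \<le> p - 1" using q by linarith
  have "I_K n \<le> 2 * (p * (p - 1)) + 3"
  proof (rule I_K_le_of_sidon[OF _ n' \<phi>])
    show "p * (p - 1) > 0" using q by simp
    have "6 * ((p - 1 choose 3) + (p - 1) * (p - 1 - 1)) \<le> (q + 1) * q * (q - 1) + 6 * ((q + 1) * q)"
      using choose_three_le[of "p - 1"] q by (simp add: distrib_left)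
    also have "\<dots> \<le> (q + 1) * (q * q + 6 * q)"
      by (simp add: algebra_simps)
    also have "\<dots> \<le> (q + 1) * ((q + 2) * (q + 14))"
      by (intro mult_left_mono) (simp_all add: algebra_simps)
    \<comment> \<open>The hypothesis on \<open>n\<close> gives
      \<open>12 * (p - 1 - n) >= p + 12\<close>, which is \<open>q + 14\<close>.\<close>
    also have "\<dots> \<le> (q + 1) * ((q + 2) * (12 * (p - 1 - n)))"
      using n12 q by (intro mult_left_mono) auto
    also have "\<dots> = 6 * (p * (p - 1) * (2 * (p - 1 - n)))"
    proof -
      have "(q + 1) * ((q + 2) * (12 * d)) = 6 * ((q + 2) * (q + 1) * (2 * d))" for d :: nat
        by (simp add: algebra_simps)
      moreover have "p - 1 = q + 1" using q by simp
      ultimately show ?thesis using q by metis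
    qed
    finally show "(p - 1 choose 3) + (p - 1) * (p - 1 - 1) \<le> p * (p - 1) * (2 * (p - 1 - n))" by simp
  qed
  also have "\<dots> \<le> 2 * p\<^sup>2" using q by (simp add: power2_eq_square algebra_simps)
  finally show ?thesis .
qed

theorem theorem4:
  shows "\<exists>f :: nat \<Rightarrow> real. (f \<longlongrightarrow> 0) sequentially \<and>
           (\<forall>\<^sub>F n in sequentially. real (I_K n) \<le> (288 / 121 + f n) * (real n)\<^sup>2)"
proof -
  \<comment> \<open>The positive part of the excess of the quotient makes the inequality immediate,
    so only the convergence to 0 needs an argument.\<close>
  define f where "f = (\<lambda>n. max 0 (real (I_K n) / (real n)\<^sup>2 - 288 / 121))"
  have "(f \<longlongrightarrow> 0) sequentially"
  proof (rule tendstoI)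
    fix e :: real assume e: "e > 0"
    \<comment> \<open>One factor \<open>1 + \<eta>\<close> pays for the gap up to the next prime,
      the other for replacing \<open>n + 2\<close> by a multiple of \<open>n\<close>. At
      \<open>\<eta> = 0\<close> the value is 2 times the square of 12/11, that is 288/121.\<close>
    have "((\<lambda>\<eta>. 2 * (1 + \<eta>)\<^sup>2 * (12 / 11 * (1 + \<eta>))\<^sup>2) \<longlongrightarrow> 2 * (1 + 0)\<^sup>2 * (12 / 11 * (1 + 0))\<^sup>2) (at_right (0::real))"
      by (intro tendsto_intros)
    hence "\<forall>\<^sub>F \<eta> in at_right (0::real). 2 * (1 + \<eta>)\<^sup>2 * (12 / 11 * (1 + \<eta>))\<^sup>2 < 288 / 121 + e"
      by (rule order_tendstoD) (use e in \<open>simp add: power2_eq_square\<close>)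
    moreover have "\<forall>\<^sub>F \<eta> in at_right (0::real). \<eta> > 0" by (simp add: eventually_at_right_less)
    ultimately have "\<forall>\<^sub>F \<eta> in at_right (0::real). \<eta> > 0 \<and> 2 * (1 + \<eta>)\<^sup>2 * (12 / 11 * (1 + \<eta>))\<^sup>2 < 288 / 121 + e"
      by eventually_elim simp
    then obtain \<eta> where \<eta>: "\<eta> > 0" "2 * (1 + \<eta>)\<^sup>2 * (12 / 11 * (1 + \<eta>))\<^sup>2 < 288 / 121 + e"
      using eventually_happens[of _ "at_right (0::real)"] by auto
    have "filterlim (\<lambda>n. 12 / 11 * (real n + 2)) at_top sequentially" by real_asymp
    from eventually_compose_filterlim[OF prime_in_short_interval[OF \<eta>(1)] this]
    have "\<forall>\<^sub>F n in sequentially. \<exists>p::nat. prime p \<and> 12 / 11 * (real n + 2) < real p \<and> real p < (1 + \<eta>) * (12 / 11 * (real n + 2))" .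
    \<comment> \<open>From \<open>2 / \<eta>\<close> on, \<open>n + 2\<close> is at most
      \<open>(1 + \<eta>) * n\<close>.\<close>
    moreover have "\<forall>\<^sub>F n in sequentially. real n \<ge> max 1 (2 / \<eta>)" 
      by (rule filterlim_real_sequentially[unfolded filterlim_at_top, rule_format])
    ultimately show "\<forall>\<^sub>F n in sequentially. dist (f n) 0 < e"
    proof eventually_elim
      case (elim n)
      then obtain p :: nat where p: "prime p" "12 / 11 * (real n + 2) < real p" "real p < (1 + \<eta>) * (12 / 11 * (real n + 2))"
        by auto
      have n: "real n \<ge> 1" "2 \<le> \<eta> * real n" using elim \<eta>(1) by (auto simp: field_simps)
      have "real (12 * (n + 2)) \<le> real (11 * p)" using p(2) by simp
      hence "12 * (n + 2) \<le> 11 * p" by (simp only: of_nat_le_iff)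
      from I_K_le_prime[OF p(1) this] have "real (I_K n) \<le> 2 * (real p)\<^sup>2"
        by (metis of_nat_le_iff of_nat_mult of_nat_numeral of_nat_power)
      also have "\<dots> \<le> 2 * ((1 + \<eta>) * (12 / 11 * ((1 + \<eta>) * real n)))\<^sup>2"
      proof -
        have "real n + 2 \<le> (1 + \<eta>) * real n" using n by (simp add: algebra_simps)
        hence "(1 + \<eta>) * (12 / 11 * (real n + 2)) \<le> (1 + \<eta>) * (12 / 11 * ((1 + \<eta>) * real n))"
          using \<eta>(1) by (intro mult_left_mono) auto
        hence "real p \<le> (1 + \<eta>) * (12 / 11 * ((1 + \<eta>) * real n))" using p(3) by linarith
        thus ?thesis by (intro mult_left_mono power_mono) auto
      qed
      also have "\<dots> = (2 * (1 + \<eta>)\<^sup>2 * (12 / 11 * (1 + \<eta>))\<^sup>2) * (real n)\<^sup>2"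
        by (simp only: power_mult_distrib mult_ac)
      finally have "real (I_K n) / (real n)\<^sup>2 \<le> 2 * (1 + \<eta>)\<^sup>2 * (12 / 11 * (1 + \<eta>))\<^sup>2"
        using n by (simp add: pos_divide_le_eq)
      thus ?case using \<eta>(2) e by (simp add: f_def dist_real_def)
    qed
  qed
  moreover have "\<forall>\<^sub>F n in sequentially. real (I_K n) \<le> (288 / 121 + f n) * (real n)\<^sup>2"
    using eventually_gt_at_top[of 0]
  proof eventually_elim
    case (elim n)
    have "real (I_K n) / (real n)\<^sup>2 \<le> 288 / 121 + f n" by (simp add: f_def)
    thus ?case using elim by (simp add: pos_divide_le_eq)
  qed
  ultimately show ?thesis by blast
qed

end
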